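(* Let $c>1$, $\alpha=1$, and let $\theta$ be a smooth admissable function with respect to $c$ and $\alpha=1$, with Fourier series $\theta(x)=\sum_{k=-\infty}^{\infty}c_ke^{ik\tilde c x}$, $\tilde c=\frac{2\pi}{\log c}$. Let $\phi_1$ be the measure on $(0,\infty)$ with $\phi_1(r,\infty)=r^{-1}\theta(\log r)$ for all $r>0$, and let $$\psi(x)=\int_{0+}^\infty\left(e^{ixy}-1-ix\sin y\right)d\phi_1(y).$$ Then for all $x\in\mathbb{R}$ $$\psi(x)=-\sum_{k\in\mathbb{Z}\setminus\{0\}}c_k\,\Gamma(ik\tilde c)\left((-ix)^{1-ik\tilde c}+ix\cos\left(\frac{\pi}{2}ik\tilde c\right)\right)-c_0\,ix\log(-ix),$$ where $0\cdot\log(0):=0$.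
   Context: Given $c>1$ and $\alpha\in(0,2)$, a function $\theta:\mathbb{R}\to(0,\infty)$ is called admissable (with respect to $c$ and $\alpha$) if it is $\log(c^{1/\alpha})$-periodic and satisfies $\theta(y+\delta)\le e^{\alpha\delta}\theta(y)$ for all $y\in\mathbb{R}$, $\delta\ge 0$. It is called smooth admissable if in addition it is continuous on $\mathbb{R}$ and piecewise continuously differentiable. Here $\alpha=1$. The function $\psi$ is the log-characteristic function corresponding to the generator $L_{\mathcal Z}^+f(x)=\int_{0+}^\infty(f(x-y)-f(x)+f'(x)\sin y)\,d\phi_1(y)$ (the positive Zolotarev semi-fractional derivative), i.e. $\widehat{L_{\mathcal Z}^+f}=\psi\widehat f$ with $\widehat f(x)=\int_{\mathbb{R}}e^{ixy}f(y)\,dy$. Complex powers and logarithms are taken with the principal branch, and $0^z=0$ for $\Re z>0$. *)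

theory Defs
  imports "HOL-Analysis.Analysis"
begin

definition admissable :: "real \<Rightarrow> real \<Rightarrow> (real \<Rightarrow> real) \<Rightarrow> bool" where
  "admissable c \<alpha> \<theta> \<longleftrightarrow>
     (\<forall>y. 0 < \<theta> y) \<and>
     (\<forall>y. \<theta> (y + ln (c powr (1 / \<alpha>))) = \<theta> y) \<and>
     (\<forall>y. \<forall>\<delta>\<ge>0. \<theta> (y + \<delta>) \<le> exp (\<alpha> * \<delta>) * \<theta> y)"

(* The library predicate allows finitely many exceptional points in the whole set, so it is
   required on bounded intervals only (a periodic function with a kink has infinitely many
   kinks on the real line).  It does not control the derivative near the exceptional points;
   the existence of its finite one-sided limits is the usual meaning of "piecewise
   continuously differentiable": continuously differentiable on each closed piece. *)
definition piecewise_C1 :: "(real \<Rightarrow> real) \<Rightarrow> bool" where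
  "piecewise_C1 f \<longleftrightarrow>
     (\<forall>a b. f piecewise_C1_differentiable_on {a..b}) \<and>
     (\<forall>x. \<exists>l. (deriv f \<longlongrightarrow> l) (at_left x)) \<and>
     (\<forall>x. \<exists>l. (deriv f \<longlongrightarrow> l) (at_right x))"

definition smooth_admissable :: "real \<Rightarrow> real \<Rightarrow> (real \<Rightarrow> real) \<Rightarrow> bool" where
  "smooth_admissable c \<alpha> \<theta> \<longleftrightarrow>
     admissable c \<alpha> \<theta> \<and> continuous_on UNIV \<theta> \<and> piecewise_C1 \<theta>"

definition fourier_coeff :: "real \<Rightarrow> (real \<Rightarrow> real) \<Rightarrow> int \<Rightarrow> complex" where
  "fourier_coeff T f k =
     (1 / of_real T) *
     integral {0..T} (\<lambda>x. of_real (f x) * exp (- \<i> * of_int k * of_real (2 * pi / T) * of_real x))"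

definition zolotarev_integrand :: "real \<Rightarrow> real \<Rightarrow> complex" where
  "zolotarev_integrand x y =
     exp (\<i> * of_real x * of_real y) - 1 - \<i> * of_real x * of_real (sin y)"

(* The lower limit 0+ of the integral is encoded in the measure, whose space is the open
   half-line of positive reals. *)
definition zolotarev_log_char :: "real measure \<Rightarrow> real \<Rightarrow> complex" where
  "zolotarev_log_char \<phi> x = (\<integral>y. zolotarev_integrand x y \<partial>\<phi>)"

end

theory Submission
  imports Defs "HOL-Library.Periodic_Fun"
begin

text \<open>
  The integrals obtained by integrating by parts against the tail of the measure converge only
  conditionally. The integrand is therefore damped: \<open>- i x\<close> is replaced by \<open>z = e - i x\<close> and
  \<open>sin y\<close> by \<open>exp (- e y) sin y\<close>, with \<open>e > 0\<close>. By Fubini, the integral of the damped function \<open>h\<close>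
  is the absolutely convergent integral of \<open>h'(t) \<theta>(ln t) / t\<close> over the half-line. The Fourier series
  of \<open>\<theta>\<close> converges absolutely (Bessel's inequality for \<open>\<theta>'\<close>), so this integral is the sum of the
  coefficients times the Mellin transforms of \<open>h'\<close> at \<open>2 \<pi> i k / ln c\<close>. Since \<open>h'\<close> is a combination of exponentials
  \<open>exp (- u t)\<close>, \<open>Re u > 0\<close>, whose coefficients add up to zero, these Mellin transforms are limits
  of \<open>Gamma s * u powr (- s)\<close> as \<open>Re s\<close> decreases to zero. Finally \<open>e\<close> tends to zero, by dominated convergence
  in the integral and in the sum; the latter needs that \<open>|Gamma (i v)| exp (\<pi> |v| / 2)\<close> is
  bounded for \<open>v\<close> away from zero, which follows from the reflection formula.
\<close>

section \<open>Fourier series of piecewise continuously differentiable functions\<close>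

text \<open>The tail integral carries the kernel \<open>1 / t\<close>, which is not integrable near
  0, so no exponential can be treated alone. Damping \<open>exp (i y)\<close> and
  \<open>exp (- i y)\<close> at the same rate, with exponents \<open>w = e + i\<close> and
  \<open>cnj w\<close>, keeps \<open>w - cnj w = 2 i\<close> for every \<open>e\<close>. This one
  identity is behind both cancellations: \<open>h'\<close> vanishes at 0, which makes its Mellin
  integrals converge, and \<open>h\<close> stays of order \<open>y^2\<close> near 0, which gives a
  multiple of \<open>min 1 (y^2)\<close> as a majorant independent of \<open>e\<close>. As
  \<open>u\<close> approaches the imaginary axis, \<open>|u powr (- i v)|\<close> may grow like
  \<open>exp (pi |v| / 2)\<close>, and the decay of \<open>Gamma (i v)\<close> is used up in
  compensating this. The Mellin transforms are therefore only known to be bounded in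
  \<open>k\<close>, and the convergence of the series has to come from the coefficients; this is why
  their absolute summability is proved. The bound fails at the index 0, which is split off and
  produces the logarithm.\<close>

definition trig :: "real \<Rightarrow> int \<Rightarrow> real \<Rightarrow> complex" where
  "trig T k x = exp (\<i> * of_int k * of_real (2 * pi / T) * of_real x)"

definition fcoef :: "real \<Rightarrow> (real \<Rightarrow> complex) \<Rightarrow> int \<Rightarrow> complex" where
  "fcoef T f k = (1 / of_real T) * integral {0..T} (\<lambda>x. f x * trig T (- k) x)"

lemma fourier_coeff_eq_fcoef: "fourier_coeff T f k = fcoef T (\<lambda>x. of_real (f x)) k"
  by (simp add: fourier_coeff_def fcoef_def trig_def)

lemma trig_0 [simp]: "trig T 0 x = 1" and trig_at_0 [simp]: "trig T k 0 = 1"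
  by (simp_all add: trig_def)

lemma trig_add_freq: "trig T (k + l) x = trig T k x * trig T l x"
  by (simp add: trig_def algebra_simps add_divide_distrib flip: exp_add)

lemma trig_add: "trig T k (x + y) = trig T k x * trig T k y"
  by (simp add: trig_def algebra_simps add_divide_distrib flip: exp_add)

lemma cnj_trig: "cnj (trig T k x) = trig T (- k) x"
  by (simp add: trig_def exp_cnj)

lemma norm_trig [simp]: "norm (trig T k x) = 1"
  by (simp add: trig_def)

lemma trig_nonzero [simp]: "trig T k x \<noteq> 0"
  by (simp add: trig_def)

lemma trig_period [simp]: "T \<noteq> 0 \<Longrightarrow> trig T k T = 1"
proof -
  assume "T \<noteq> 0"
  then have "trig T k T = exp (2 * of_int k * pi * \<i>)"
    by (simp add: trig_def field_simps)
  then show ?thesis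
    using exp_integer_2pi[of "of_int k"] by (simp add: mult_ac)
qed

lemma has_vector_derivative_trig:
  "(trig T k has_vector_derivative \<i> * of_int k * of_real (2 * pi / T) * trig T k x) (at x within S)"
proof -
  have "((\<lambda>z. exp (a * z)) has_field_derivative a * exp (a * of_real x)) (at (of_real x))" for a :: complex
    by (auto intro!: derivative_eq_intros)
  then have "((\<lambda>z. exp (\<i> * of_int k * of_real (2 * pi / T) * z)) has_field_derivative
      \<i> * of_int k * of_real (2 * pi / T) * trig T k x) (at (of_real x))"
    unfolding trig_def by blast
  then have "((\<lambda>x. exp (\<i> * of_int k * of_real (2 * pi / T) * of_real x)) has_vector_derivative
      \<i> * of_int k * of_real (2 * pi / T) * trig T k x) (at x)"
    by (rule has_vector_derivative_real_field)
  then show ?thesis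
    by (simp add: trig_def[abs_def] has_vector_derivative_at_within)
qed

lemma continuous_on_trig [continuous_intros]: "continuous_on S (trig T k)"
  unfolding trig_def by (intro continuous_intros)

lemma has_integral_trig:
  assumes "T > 0"
  shows "(trig T k has_integral (if k = 0 then of_real T else 0)) {0..T}"
proof (cases "k = 0")
  case True
  then show ?thesis
    using has_integral_const_real[of "1 :: complex" 0 T] assms by (simp add: trig_def[abs_def] scaleR_conv_of_real)
next
  case False
  define a where "a = \<i> * of_int k * of_real (2 * pi / T)"
  have a: "a \<noteq> 0"
    using False assms by (simp add: a_def divide_eq_0_iff)
  have "((\<lambda>x. a * trig T k x) has_integral (trig T k T - trig T k 0)) {0..T}"
    using assms unfolding a_def
    by (intro fundamental_theorem_of_calculus has_vector_derivative_trig) auto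
  then have "((\<lambda>x. a * trig T k x) has_integral 0) {0..T}"
    using assms by simp
  from has_integral_mult_right[OF this, of "1 / a"] show ?thesis
    using False a by simp
qed

section \<open>Bessel's inequality for bounded measurable functions\<close>

lemma integrable_bounded_lebesgue_on:
  fixes f :: "real \<Rightarrow> complex"
  assumes "f \<in> borel_measurable (lebesgue_on {a..b})" "\<And>x. x \<in> {a..b} \<Longrightarrow> norm (f x) \<le> B"
  shows "f integrable_on {a..b}"
  by (rule measurable_bounded_by_integrable_imp_integrable[OF assms(1) integrable_const_ivl assms(2)]) auto

lemma trig_measurable [measurable]: "trig T k \<in> borel_measurable (lebesgue_on {a..b})"
  by (rule continuous_imp_measurable_on_sets_lebesgue) (auto intro: continuous_intros)

lemma has_integral_fcoef:
  assumes T: "T > 0"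
    and f: "f \<in> borel_measurable (lebesgue_on {0..T})" "\<And>x. x \<in> {0..T} \<Longrightarrow> norm (f x) \<le> B"
  shows "((\<lambda>x. f x * trig T (- k) x) has_integral of_real T * fcoef T f k) {0..T}"
proof -
  have "(\<lambda>x. f x * trig T (- k) x) integrable_on {0..T}"
    using f by (intro integrable_bounded_lebesgue_on[where B = B]) (auto simp: norm_mult)
  then show ?thesis
    using T by (simp add: fcoef_def has_integral_integral)
qed

text \<open>By orthogonality, the nonnegative integral of \<open>|f - S|^2\<close> over a period
  equals the integral of \<open>|f|^2\<close>, which is at most \<open>B^2 * T\<close>, minus
  \<open>T\<close> times the sum of the squared coefficients. Boundedness and measurability suffice,
  so the inequality applies to a derivative with jumps.\<close>

lemma bessel:
  assumes T: "T > 0"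
    and f: "f \<in> borel_measurable (lebesgue_on {0..T})" "\<And>x. x \<in> {0..T} \<Longrightarrow> norm (f x) \<le> B"
    and F: "finite F"
  shows "(\<Sum>k\<in>F. (norm (fcoef T f k))\<^sup>2) \<le> B\<^sup>2"
proof -
  define c where "c = fcoef T f"
  define S where "S x = (\<Sum>k\<in>F. c k * trig T k x)" for x
  note f(1) [measurable]
  have "0 \<le> norm (f 0)" "norm (f 0) \<le> B" using T f(2)[of 0] by auto
  then have B: "B \<ge> 0" by linarith
  have h1: "((\<lambda>x. f x * trig T (- k) x) has_integral of_real T * c k) {0..T}" for k
    unfolding c_def using has_integral_fcoef[OF T f] by blast
  have h2: "((\<lambda>x. cnj (f x) * trig T k x) has_integral of_real T * cnj (c k)) {0..T}" for k
    using h1[of k] has_integral_cnj[of "\<lambda>x. f x * trig T (- k) x" "of_real T * c k" "{0..T}"]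
    by (simp add: o_def cnj_trig)
  define A where "A = integral {0..T} (\<lambda>x. f x * cnj (f x))"
  have "(\<lambda>x. f x * cnj (f x)) integrable_on {0..T}"
  proof (rule integrable_bounded_lebesgue_on[where B = "B * B"])
    have "(\<lambda>x. cnj (f x)) \<in> borel_measurable (lebesgue_on {0..T})"
      by (rule borel_measurable_continuous_on[OF _ f(1)]) (intro continuous_intros)
    then show "(\<lambda>x. f x * cnj (f x)) \<in> borel_measurable (lebesgue_on {0..T})"
      by simp
  qed (use f(2) B in \<open>auto simp: norm_mult intro!: mult_mono\<close>)
  then have hA: "((\<lambda>x. f x * cnj (f x)) has_integral A) {0..T}"
    by (simp add: A_def has_integral_integral)
  \<comment> \<open>The square is expanded into products whose integrals are known: coefficients of
    \<open>f\<close>, their conjugates, and single harmonics of frequency \<open>k - l\<close>, of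
    which only the diagonal survives.\<close>
  have e: "(f x - S x) * cnj (f x - S x) = f x * cnj (f x) - (\<Sum>k\<in>F. cnj (c k) * (f x * trig T (- k) x))
      - (\<Sum>k\<in>F. c k * (cnj (f x) * trig T k x)) + (\<Sum>k\<in>F. \<Sum>l\<in>F. (c k * cnj (c l)) * trig T (k - l) x)" for x
  proof -
    have "(\<Sum>k\<in>F. \<Sum>l\<in>F. (c k * cnj (c l)) * trig T (k - l) x) = S x * cnj (S x)"
      by (simp add: S_def cnj_trig sum_product mult_ac trig_add_freq[of T _ "- _", simplified])
    then show ?thesis
      by (simp add: S_def cnj_trig algebra_simps sum_distrib_left sum_distrib_right)
  qed
  have "((\<lambda>x. (f x - S x) * cnj (f x - S x)) has_integral
      (A - (\<Sum>k\<in>F. cnj (c k) * (of_real T * c k)) - (\<Sum>k\<in>F. c k * (of_real T * cnj (c k)))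
       + (\<Sum>k\<in>F. \<Sum>l\<in>F. (c k * cnj (c l)) * (if k - l = 0 then of_real T else 0)))) {0..T}"
    unfolding e
    by (intro has_integral_add has_integral_diff has_integral_sum F has_integral_mult_right h1 h2 hA
        has_integral_trig[OF T])
  also have "(\<Sum>k\<in>F. \<Sum>l\<in>F. (c k * cnj (c l)) * (if k - l = 0 then of_real T else 0)) =
      (\<Sum>k\<in>F. c k * cnj (c k) * of_real T)"
    using F by (intro sum.cong) (auto simp: if_distrib cong: if_cong)
  also have "A - (\<Sum>k\<in>F. cnj (c k) * (of_real T * c k)) - (\<Sum>k\<in>F. c k * (of_real T * cnj (c k)))
       + (\<Sum>k\<in>F. c k * cnj (c k) * of_real T) = A - of_real (T * (\<Sum>k\<in>F. (norm (c k))\<^sup>2))"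
  proof -
    have "of_real (T * (\<Sum>k\<in>F. (norm (c k))\<^sup>2)) = (\<Sum>k\<in>F. c k * cnj (c k) * of_real T)"
      by (simp add: complex_norm_square sum_distrib_left mult_ac del: of_real_power)
    then show ?thesis
      by (simp add: mult_ac)
  qed
  finally have hi: "((\<lambda>x. (f x - S x) * cnj (f x - S x)) has_integral
      A - of_real (T * (\<Sum>k\<in>F. (norm (c k))\<^sup>2))) {0..T}" .
  have "0 \<le> Re (A - of_real (T * (\<Sum>k\<in>F. (norm (c k))\<^sup>2)))"
    using has_integral_linear[OF hi bounded_linear_Re]
    by (rule has_integral_nonneg) (simp only: o_def complex_mult_cnj Re_complex_of_real, simp)
  moreover have "Re A \<le> B\<^sup>2 * T"
  proof -
    have "((\<lambda>x. Re (f x * cnj (f x))) has_integral Re A) {0..T}"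
      using has_integral_linear[OF hA bounded_linear_Re] by (simp add: o_def)
    moreover have "((\<lambda>x. B\<^sup>2) has_integral B\<^sup>2 * T) {0..T}"
      using has_integral_const_real[of "B\<^sup>2" 0 T] T by (simp add: mult.commute)
    moreover have "Re (f x * cnj (f x)) \<le> B\<^sup>2" if "x \<in> {0..T}" for x
      using power_mono[OF f(2)[OF that], of 2] by (simp add: complex_mult_cnj cmod_power2)
    ultimately show ?thesis
      by (rule has_integral_le)
  qed
  ultimately have "T * (\<Sum>k\<in>F. (norm (c k))\<^sup>2) \<le> T * B\<^sup>2"
    by (simp add: mult.commute)
  then show ?thesis
    using T by (simp add: c_def)
qed

lemma fcoef_summable_square:
  assumes "T > 0"
    and "f \<in> borel_measurable (lebesgue_on {0..T})" "\<And>x. x \<in> {0..T} \<Longrightarrow> norm (f x) \<le> B"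
  shows "(\<lambda>k. (norm (fcoef T f k))\<^sup>2) summable_on UNIV"
proof (rule nonneg_bdd_above_summable_on)
  show "bdd_above (sum (\<lambda>k. (norm (fcoef T f k))\<^sup>2) ` {F. F \<subseteq> UNIV \<and> finite F})"
    using bessel[OF assms] by (intro bdd_aboveI[where M = "B\<^sup>2"]) blast
qed auto

text \<open>The one-sided limits bound the derivative in a neighbourhood of each point; the
  bisection principle \<open>Bolzano\<close> turns these local bounds into one on the whole
  interval.\<close>

lemma deriv_bounded_interval:
  fixes f :: "real \<Rightarrow> real"
  assumes l: "\<And>x. \<exists>l. (deriv f \<longlongrightarrow> l) (at_left x)" and r: "\<And>x. \<exists>l. (deriv f \<longlongrightarrow> l) (at_right x)"
    and ab: "a \<le> b"
  shows "\<exists>B. \<forall>y\<in>{a..b}. \<bar>deriv f y\<bar> \<le> B"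
  using ab
proof (induction rule: Bolzano)
  case (trans a b c)
  then obtain B B' where "\<forall>y\<in>{a..b}. \<bar>deriv f y\<bar> \<le> B" "\<forall>y\<in>{b..c}. \<bar>deriv f y\<bar> \<le> B'" by blast
  then have "\<forall>y\<in>{a..c}. \<bar>deriv f y\<bar> \<le> max B B'"
    by (auto simp: le_max_iff_disj)
  then show ?case by blast
next
  case (local x)
  have *: "\<exists>B. eventually (\<lambda>y. \<bar>deriv f y\<bar> \<le> B) F" if "\<exists>l. (deriv f \<longlongrightarrow> l) F" for F
  proof -
    from that obtain l where "(deriv f \<longlongrightarrow> l) F" by blast
    then have "eventually (\<lambda>y. dist (deriv f y) l < 1) F"
      by (rule tendstoD) simp
    then have "eventually (\<lambda>y. \<bar>deriv f y\<bar> \<le> \<bar>l\<bar> + 1) F"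
      by (rule eventually_mono) (auto simp: dist_real_def)
    then show ?thesis by blast
  qed
  obtain B1 B2 where B: "eventually (\<lambda>y. \<bar>deriv f y\<bar> \<le> B1) (at_left x)" "eventually (\<lambda>y. \<bar>deriv f y\<bar> \<le> B2) (at_right x)"
    using *[OF l] *[OF r] by blast
  \<comment> \<open>The one-sided limits say nothing about \<open>deriv f x\<close> itself, which is
    an unspecified number at a kink and has to enter the bound separately.\<close>
  define B where "B = max (max B1 B2) \<bar>deriv f x\<bar>"
  have "eventually (\<lambda>y. \<bar>deriv f y\<bar> \<le> B) (at x)"
    unfolding eventually_at_split using B by (auto simp: B_def elim!: eventually_mono)
  then obtain d where d: "d > 0" "\<And>y. y \<noteq> x \<Longrightarrow> dist y x < d \<Longrightarrow> \<bar>deriv f y\<bar> \<le> B"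
    unfolding eventually_at by auto
  have "\<bar>deriv f y\<bar> \<le> B" if "dist y x < d" for y
    using d(2)[OF _ that] by (cases "y = x") (auto simp: B_def)
  then have "\<forall>y\<in>{a..b}. \<bar>deriv f y\<bar> \<le> B" if "a \<le> x \<and> x \<le> b \<and> b - a < d" for a b
    using that by (auto simp: dist_real_def)
  then show ?case
    using d(1) by blast
qed

lemma fcoef_derivative:
  fixes f D :: "real \<Rightarrow> complex"
  assumes T: "T > 0" and per: "f T = f 0" and cont: "continuous_on {0..T} f"
    and F: "finite F" "\<And>x. x \<in> {0<..<T} - F \<Longrightarrow> (f has_vector_derivative D x) (at x)"
    and D: "D \<in> borel_measurable (lebesgue_on {0..T})" "\<And>x. x \<in> {0..T} \<Longrightarrow> norm (D x) \<le> B"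
  shows "fcoef T D k = \<i> * of_int k * of_real (2 * pi / T) * fcoef T f k"
proof -
  define a where "a = \<i> * of_int k * of_real (2 * pi / T)"
  have 1: "((\<lambda>x. f x * (- a * trig T (- k) x) + D x * trig T (- k) x) has_integral
     f T * trig T (- k) T - f 0 * trig T (- k) 0) {0..T}"
  proof (rule fundamental_theorem_of_calculus_interior_strong[OF F(1)])
    fix x assume x: "x \<in> {0<..<T} - F"
    show "((\<lambda>x. f x * trig T (- k) x) has_vector_derivative
       f x * (- a * trig T (- k) x) + D x * trig T (- k) x) (at x)"
      using has_vector_derivative_mult[OF F(2)[OF x] has_vector_derivative_trig[of T "- k"]] by (simp add: a_def)
  qed (use T cont in \<open>auto intro!: continuous_intros\<close>)
  have "(\<lambda>x. f x * trig T (- k) x) integrable_on {0..T}"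
    using cont by (intro integrable_continuous_interval continuous_intros)
  then have 2: "((\<lambda>x. f x * trig T (- k) x) has_integral of_real T * fcoef T f k) {0..T}"
    using T by (simp add: fcoef_def has_integral_integral)
  have 3: "((\<lambda>x. D x * trig T (- k) x) has_integral of_real T * fcoef T D k) {0..T}"
    using has_integral_fcoef[OF T D] by blast
  have "((\<lambda>x. f x * (- a * trig T (- k) x) + D x * trig T (- k) x) has_integral
     - a * (of_real T * fcoef T f k) + of_real T * fcoef T D k) {0..T}"
    using has_integral_add[OF has_integral_mult_right[OF 2, of "- a"] 3] by (simp add: mult_ac)
  from has_integral_unique[OF this 1] show ?thesis
    using T per by (simp add: a_def field_simps)
qed

section \<open>Absolute summability of the Fourier coefficients\<close>

lemma summable_on_int_inverse_square: "(\<lambda>k::int. 1 / (of_int k)\<^sup>2 :: real) summable_on UNIV"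
proof -
  have "summable (\<lambda>n. 1 / (of_nat (Suc n))\<^sup>2 :: real)"
    using inverse_squares_sums by (simp add: sums_iff add.commute)
  then have "summable (\<lambda>n. 1 / (of_nat n)\<^sup>2 :: real)"
    by (subst (asm) summable_Suc_iff)
  then have s: "(\<lambda>n. 1 / (of_nat n)\<^sup>2 :: real) summable_on UNIV"
    by (intro norm_summable_imp_summable_on) simp
  have "(\<lambda>k::int. 1 / (of_int k)\<^sup>2 :: real) summable_on (range int)"
    by (subst summable_on_reindex) (use s in \<open>auto simp: o_def\<close>)
  moreover have "(\<lambda>k::int. 1 / (of_int k)\<^sup>2 :: real) summable_on (range (\<lambda>n. - int n))"
    by (subst summable_on_reindex) (use s in \<open>auto simp: o_def inj_def\<close>)
  ultimately have "(\<lambda>k::int. 1 / (of_int k)\<^sup>2 :: real) summable_on (range int \<union> range (\<lambda>n. - int n))"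
    by (rule summable_on_union)
  also have "range int \<union> range (\<lambda>n. - int n) = UNIV"
    by (auto simp: image_def) (metis int_cases2)
  finally show ?thesis .
qed

text \<open>For \<open>k \<noteq> 0\<close> the coefficient of \<open>f\<close> is in modulus that
  of \<open>D\<close> times \<open>T / (2 pi |k|)\<close>. The inequality
  \<open>u * v \<le> u^2 + v^2\<close> bounds this product by two squares, summable by Bessel's
  inequality and by the inverse square series.\<close>

lemma fcoef_abs_summable:
  fixes f D :: "real \<Rightarrow> complex"
  assumes T: "T > 0" and per: "f T = f 0" and cont: "continuous_on {0..T} f"
    and F: "finite F" "\<And>x. x \<in> {0<..<T} - F \<Longrightarrow> (f has_vector_derivative D x) (at x)"
    and D: "D \<in> borel_measurable (lebesgue_on {0..T})" "\<And>x. x \<in> {0..T} \<Longrightarrow> norm (D x) \<le> B"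
  shows "(\<lambda>k. norm (fcoef T f k)) summable_on UNIV"
proof -
  define g where "g k = (norm (fcoef T D k))\<^sup>2 + (T / (2 * pi))\<^sup>2 * (1 / (of_int k)\<^sup>2)" for k
  have "(\<lambda>k. (norm (fcoef T D k))\<^sup>2) summable_on UNIV"
    using fcoef_summable_square[OF T D] by blast
  then have "g summable_on UNIV"
    unfolding g_def by (intro summable_on_add summable_on_cmult_right summable_on_int_inverse_square)
  then have "g summable_on UNIV - {0}"
    by (rule summable_on_subset_banach) auto
  then have "(\<lambda>k. norm (fcoef T f k)) summable_on UNIV - {0}"
  proof (rule summable_on_comparison_test)
    fix k :: int assume "k \<in> UNIV - {0}"
    define u v where "u = norm (fcoef T D k)" and "v = T / (2 * pi) * (1 / \<bar>of_int k\<bar>)"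
    have "norm (fcoef T f k) = u * v"
      using fcoef_derivative[OF T per cont F D, of k] T \<open>k \<in> _\<close>
      by (simp add: u_def v_def norm_mult norm_divide)
    also have "\<dots> \<le> u\<^sup>2 + v\<^sup>2"
    proof -
      have "2 * (u * v) \<le> u\<^sup>2 + v\<^sup>2" using sum_squares_bound[of u v] by simp
      moreover have "u * v \<ge> 0" using T by (simp add: u_def v_def)
      ultimately show ?thesis by linarith
    qed
    also have "\<dots> = g k"
      by (simp add: g_def u_def v_def power_mult_distrib power_divide)
    finally show "norm (fcoef T f k) \<le> g k" .
  qed auto
  then have "(\<lambda>k. norm (fcoef T f k)) summable_on insert 0 (UNIV - {0})"
    by (subst summable_on_insert_iff) auto
  then show ?thesis
    by (simp add: insert_Diff)
qed

section \<open>Pointwise convergence of the Fourier series\<close>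

text \<open>The Riemann-Lebesgue lemma by counting: Bessel's inequality allows at most
  \<open>B^2 / e^2\<close> coefficients of modulus at least \<open>e\<close>.\<close>

lemma fcoef_tendsto_0:
  assumes "T > 0" and "continuous_on {0..T} g"
  shows "(fcoef T g \<longlongrightarrow> 0) cofinite"
proof -
  obtain B where B: "\<And>x. x \<in> {0..T} \<Longrightarrow> norm (g x) \<le> B"
    using compact_continuous_image[OF assms(2)] compact_imp_bounded
    by (metis bounded_iff compact_Icc imageI)
  have "eventually (\<lambda>k. norm (fcoef T g k) < e) cofinite" if "e > 0" for e
  proof -
    have fin: "card F \<le> nat \<lfloor>B\<^sup>2 / e\<^sup>2\<rfloor>" if F: "finite F" "F \<subseteq> {k. \<not> norm (fcoef T g k) < e}" for F
    proof -
      have "of_nat (card F) * e\<^sup>2 = (\<Sum>k\<in>F. e\<^sup>2)" by simp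
      also have "\<dots> \<le> (\<Sum>k\<in>F. (norm (fcoef T g k))\<^sup>2)"
        using F \<open>e > 0\<close> by (intro sum_mono power_mono) auto
      also have "\<dots> \<le> B\<^sup>2"
        using assms B F by (intro bessel continuous_imp_measurable_on_sets_lebesgue) auto
      finally have "of_nat (card F) \<le> B\<^sup>2 / e\<^sup>2"
        using \<open>e > 0\<close> by (simp add: field_simps)
      then show ?thesis by (rule le_nat_floor)
    qed
    then show ?thesis
      unfolding eventually_cofinite using finite_if_finite_subsets_card_bdd[OF fin] by blast
  qed
  then show ?thesis by (intro tendstoI) (auto simp: dist_norm)
qed

text \<open>Provides the continuous quotient to which the Riemann-Lebesgue lemma is applied in the
  telescoping argument; the value \<open>d\<close> fills the gap at \<open>u\<close>.\<close>

lemma continuous_on_slope: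
  fixes f :: "real \<Rightarrow> complex"
  assumes d: "(f has_vector_derivative d) (at u)" and f: "continuous_on S f"
  shows "continuous_on S (\<lambda>x. if x = u then d else (f x - f u) / of_real (x - u))"
    (is "continuous_on S ?h")
  unfolding continuous_on_eq_continuous_within
proof
  fix x assume x: "x \<in> S"
  show "continuous (at x within S) ?h"
  proof (cases "x = u")
    case True
    have "((\<lambda>y. ((f y - f u) - (y - u) *\<^sub>R d) /\<^sub>R norm (y - u)) \<longlongrightarrow> 0) (at u)"
      using d by (simp add: has_vector_derivative_def has_derivative_at_within divide_inverse_commute scaleR_conv_of_real) 
    then have "((\<lambda>y. norm (((f y - f u) - (y - u) *\<^sub>R d) /\<^sub>R norm (y - u))) \<longlongrightarrow> 0) (at u)"
      by (rule tendsto_norm_zero)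
    moreover have "eventually (\<lambda>y. norm (((f y - f u) - (y - u) *\<^sub>R d) /\<^sub>R norm (y - u)) = norm (?h y - d)) (at u)"
      unfolding eventually_at_filter
      by (auto simp: norm_divide norm_mult field_simps scaleR_conv_of_real divide_simps simp flip: of_real_diff
          intro!: always_eventually) 
    ultimately have "((\<lambda>y. norm (?h y - d)) \<longlongrightarrow> 0) (at u)"
      by (rule Lim_transform_eventually)
    then have "(?h \<longlongrightarrow> ?h u) (at u)"
      by (simp add: tendsto_norm_zero_iff LIM_zero_iff)
    then show ?thesis
      unfolding True continuous_within by (rule tendsto_within_subset) simp
  next
    case False
    have "continuous (at x within S) (\<lambda>x. (f x - f u) / of_real (x - u))"
      using f x False by (intro continuous_intros) (auto simp: continuous_on_eq_continuous_within)
    moreover have "eventually (\<lambda>y. y \<noteq> u) (at x within S)"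
      using False by (intro tendsto_imp_eventually_ne[OF tendsto_ident_at])
    then have "eventually (\<lambda>y. (f y - f u) / of_real (y - u) = ?h y) (at x within S)"
      by (rule eventually_mono) simp
    ultimately show ?thesis
      unfolding continuous_within using False by (simp add: tendsto_cong)
  qed
qed

lemma trig_1_eq_1_iff:
  assumes "T > 0" "\<bar>x\<bar> < T"
  shows "trig T 1 x = 1 \<longleftrightarrow> x = 0"
proof
  assume "trig T 1 x = 1"
  then obtain n :: int where "2 * pi / T * x = of_int (2 * n) * pi"
    unfolding trig_def exp_eq_1 by auto
  then have n: "x = of_int n * T"
    using assms by (simp add: field_simps)
  then have "\<bar>of_int n :: real\<bar> < 1"
    using assms by (simp add: abs_mult)
  then have "n = 0" by linarith
  then show "x = 0" using n by simp
qed simp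

lemma sum_int_telescope:
  fixes b :: "int \<Rightarrow> 'a::ab_group_add"
  shows "(\<Sum>k = - int N..int N. b (k - 1) - b k) = b (- int N - 1) - b (int N)"
proof (induction N)
  case (Suc N)
  have "{- int (Suc N)..int (Suc N)} = insert (- int N - 1) (insert (int N + 1) {- int N..int N})"
    by auto
  then show ?case using Suc by (simp add: algebra_simps)
qed simp

(* Chernoff's telescoping argument. *)
lemma fourier_tendsto_at_differentiable:
  assumes T: "T > 0" and f: "continuous_on {0..T} f" and u: "u \<in> {0<..<T}"
    and d: "(f has_vector_derivative d) (at u)"
  shows "(\<lambda>N. \<Sum>k = - int N..int N. fcoef T f k * trig T k u) \<longlonglongrightarrow> f u"
proof -
  define a where "a = \<i> * of_real (2 * pi / T)"
  \<comment> \<open>This is \<open>exp (2 pi i (x - u) / T) - 1\<close>. As \<open>u\<close> is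
    interior to the period, \<open>u\<close> is its only zero there, so \<open>f - f u\<close> can
    be divided by it.\<close>
  define p where "p x = trig T 1 x * trig T (- 1) u - 1" for x
  have uu: "trig T 1 u * trig T (- 1) u = 1"
    by (simp flip: trig_add_freq)
  have p: "(p has_vector_derivative a) (at u)"
    unfolding p_def
    using has_vector_derivative_diff_const[THEN iffD2, OF has_vector_derivative_mult_left[OF has_vector_derivative_trig[of T 1 u UNIV], of "trig T (- 1) u"], of 1]
    by (simp add: a_def uu mult.assoc)
  have pu: "p u = 0" by (simp add: p_def uu)
  have p0: "p x \<noteq> 0" if "x \<in> {0..T}" "x \<noteq> u" for x
  proof
    assume "p x = 0"
    then have "trig T 1 x * trig T (- 1) u = trig T 1 u * trig T (- 1) u"
      using uu by (simp add: p_def)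
    then have "trig T 1 (x - u + u) = trig T 1 u"
      by simp
    then have "trig T 1 (x - u) = 1"
      unfolding trig_add by simp
    then show False
      using that u T by (subst (asm) trig_1_eq_1_iff) auto
  qed
  define r where "r x = (if x = u then d else (f x - f u) / of_real (x - u))" for x
  define q where "q x = (if x = u then a else (p x - p u) / of_real (x - u))" for x
  \<comment> \<open>Away from \<open>u\<close> this is \<open>(f x - f u) / p x\<close>. Dividing
    numerator and denominator by \<open>x - u\<close> first makes the quotient continuous at
    \<open>u\<close> as well, because the derivative \<open>a\<close> of \<open>p\<close> is not
    0.\<close>
  define g where "g x = r x / q x" for x
  have q0: "q x \<noteq> 0" if "x \<in> {0..T}" for x
    using p0[OF that] T by (auto simp: q_def pu a_def divide_eq_0_iff simp flip: of_real_diff)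
  have g: "continuous_on {0..T} g"
    unfolding g_def
  proof (rule continuous_on_divide)
    show "continuous_on {0..T} r"
      unfolding r_def by (rule continuous_on_slope[OF d f])
    show "continuous_on {0..T} q"
      unfolding q_def by (rule continuous_on_slope[OF p]) (auto simp: p_def[abs_def] intro!: continuous_intros)
  qed (use q0 in auto)
  have fg: "f x - f u = g x * p x" if "x \<in> {0..T}" for x
    using q0[OF that] p0[OF that] by (cases "x = u") (auto simp: g_def r_def q_def pu)
  define b where "b k = fcoef T g k * trig T k u" for k
  have hf: "((\<lambda>x. h x * trig T (- k) x) has_integral of_real T * fcoef T h k) {0..T}"
    if "continuous_on {0..T} h" for h k
  proof -
    have "(\<lambda>x. h x * trig T (- k) x) integrable_on {0..T}"
      using that by (intro integrable_continuous_interval continuous_intros)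
    then show ?thesis
      using T by (simp add: fcoef_def has_integral_integral)
  qed
  \<comment> \<open>Subtracting the constant \<open>f u\<close> affects only the coefficient of
    index 0. The factor \<open>p\<close> replaces the coefficient of \<open>g\<close> at
    \<open>k\<close> by a multiple of the one at \<open>k - 1\<close> minus the one at
    \<open>k\<close>; after multiplication by \<open>trig T k u\<close> this is a difference of
    consecutive values of \<open>b\<close>.\<close>
  have coef: "fcoef T f k * trig T k u - (if k = 0 then f u else 0) = b (k - 1) - b k" for k
  proof -
    have "((\<lambda>x. f x * trig T (- k) x - f u * trig T (- k) x) has_integral
        of_real T * fcoef T f k - f u * (if k = 0 then of_real T else 0)) {0..T}"
      using has_integral_diff[OF hf[OF f, of k] has_integral_mult_right[OF has_integral_trig[OF T, of "- k"], of "f u"]]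
      by simp
    moreover have "((\<lambda>x. trig T (- 1) u * (g x * trig T (- (k - 1)) x) - g x * trig T (- k) x) has_integral
        trig T (- 1) u * (of_real T * fcoef T g (k - 1)) - of_real T * fcoef T g k) {0..T}"
      by (intro has_integral_diff has_integral_mult_right hf g)
    moreover have "trig T (- 1) u * (g x * trig T (- (k - 1)) x) - g x * trig T (- k) x
        = f x * trig T (- k) x - f u * trig T (- k) x" if "x \<in> {0..T}" for x
    proof -
      have "trig T (- (k - 1)) x = trig T (- k) x * trig T 1 x"
        by (simp flip: trig_add_freq)
      then have "trig T (- 1) u * (g x * trig T (- (k - 1)) x) - g x * trig T (- k) x = (g x * p x) * trig T (- k) x"
        by (simp add: p_def algebra_simps)
      then show ?thesis
        using fg[OF that] by (simp add: algebra_simps)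
    qed
    ultimately have "of_real T * fcoef T f k - f u * (if k = 0 then of_real T else 0) =
        trig T (- 1) u * (of_real T * fcoef T g (k - 1)) - of_real T * fcoef T g k"
      by (metis (no_types, lifting) has_integral_eq has_integral_unique)
    then have "of_real T * (fcoef T f k - (if k = 0 then f u else 0)) =
        of_real T * (trig T (- 1) u * fcoef T g (k - 1) - fcoef T g k)"
      by (simp add: algebra_simps split: if_splits)
    then have "fcoef T f k - (if k = 0 then f u else 0) = trig T (- 1) u * fcoef T g (k - 1) - fcoef T g k"
      using T by simp
    then have "(fcoef T f k - (if k = 0 then f u else 0)) * trig T k u
       = (trig T (- 1) u * fcoef T g (k - 1) - fcoef T g k) * trig T k u"
      by (rule arg_cong)
    also have "\<dots> = fcoef T g (k - 1) * (trig T (- 1) u * trig T k u) - fcoef T g k * trig T k u"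
      by (simp add: algebra_simps)
    also have "trig T (- 1) u * trig T k u = trig T (k - 1) u"
      by (simp flip: trig_add_freq)
    finally have "(fcoef T f k - (if k = 0 then f u else 0)) * trig T k u = b (k - 1) - b k"
      by (simp add: b_def)
    then show ?thesis
      by (cases "k = 0") (simp_all add: algebra_simps)
  qed
  have sum: "(\<Sum>k = - int N..int N. fcoef T f k * trig T k u) = f u + (b (- int N - 1) - b (int N))" for N
  proof -
    have "(\<Sum>k = - int N..int N. fcoef T f k * trig T k u) - (\<Sum>k = - int N..int N. if k = 0 then f u else 0)
        = b (- int N - 1) - b (int N)"
      unfolding sum_subtractf[symmetric] coef sum_int_telescope ..
    then show ?thesis by (simp add: algebra_simps)
  qed
  \<comment> \<open>Harmonics have modulus 1, so \<open>b\<close> inherits the decay of the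
    coefficients of \<open>g\<close>. The two indices left by telescoping eventually avoid every
    finite set.\<close>
  have "((\<lambda>k. norm (b k)) \<longlongrightarrow> 0) cofinite"
    using tendsto_norm_zero[OF fcoef_tendsto_0[OF T g]] by (simp add: b_def norm_mult)
  then have b0: "(b \<longlongrightarrow> 0) cofinite"
    by (rule tendsto_norm_zero_cancel)
  have inj: "(\<lambda>N. b (h N)) \<longlonglongrightarrow> 0" if "inj h" for h :: "nat \<Rightarrow> int"
  proof (rule filterlim_compose[OF b0])
    show "filterlim h cofinite sequentially"
      unfolding filterlim_iff cofinite_eq_sequentially[symmetric] eventually_cofinite
    proof (intro allI impI)
      fix P :: "int \<Rightarrow> bool" assume "finite {k. \<not> P k}"
      from finite_vimageI[OF this that] show "finite {N. \<not> P (h N)}"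
        by (simp add: vimage_def)
    qed
  qed
  have "(\<lambda>N. f u + (b (- int N - 1) - b (int N))) \<longlonglongrightarrow> f u + (0 - 0)"
    by (intro tendsto_add tendsto_diff tendsto_const inj injI) auto
  then show ?thesis by (simp add: sum)
qed

text \<open>Connects unordered summation, in which absolute summability is expressed, with the
  sequence of symmetric partial sums that telescoping and dominated convergence require.\<close>

lemma filterlim_int_interval: "filterlim (\<lambda>N. {- int N..int N}) (finite_subsets_at_top UNIV) sequentially"
  unfolding filterlim_finite_subsets_at_top
proof safe
  fix X :: "int set" assume X: "finite X"
  define M where "M = nat (Max (insert 0 (abs ` X)))"
  have "\<bar>x\<bar> \<le> int M" if "x \<in> X" for x
    using X that by (auto simp: M_def nat_le_iff intro!: Max_ge)
  then have "X \<subseteq> {- int N..int N}" if "N \<ge> M" for N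
    using that by fastforce
  then show "\<forall>\<^sub>F N in sequentially. finite {- int N..int N} \<and> X \<subseteq> {- int N..int N} \<and> {- int N..int N} \<subseteq> UNIV"
    unfolding eventually_sequentially by auto
qed

lemma has_sum_imp_symmetric_limit:
  "(f has_sum S) UNIV \<Longrightarrow> (\<lambda>N. \<Sum>k = - int N..int N. f k) \<longlonglongrightarrow> S"
  unfolding has_sum_def by (rule filterlim_compose[OF _ filterlim_int_interval])

text \<open>Absolute summability makes the sum \<open>S\<close> continuous, by the Weierstrass test.
  It agrees with \<open>f\<close> at the points of differentiability inside a period, which are
  dense there; continuity extends the equality to the closed period and periodicity to the
  line.\<close>

lemma fourier_series:
  fixes f D :: "real \<Rightarrow> complex"
  assumes T: "T > 0" and per: "\<And>x. f (x + T) = f x" and cont: "continuous_on UNIV f"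
    and F: "finite F" "\<And>x. x \<in> {0<..<T} - F \<Longrightarrow> (f has_vector_derivative D x) (at x)"
    and D: "D \<in> borel_measurable (lebesgue_on {0..T})" "\<And>x. x \<in> {0..T} \<Longrightarrow> norm (D x) \<le> B"
  shows "((\<lambda>k. fcoef T f k * trig T k u) has_sum f u) UNIV"
proof -
  have c: "continuous_on {0..T} f"
    using cont by (rule continuous_on_subset) simp
  have "f T = f 0" using per[of 0] by simp
  then have summ: "(\<lambda>k. norm (fcoef T f k)) summable_on UNIV"
    by (rule fcoef_abs_summable[OF T _ c F D])
  define S where "S u = (\<Sum>\<^sub>\<infinity>k. fcoef T f k * trig T k u)" for u
  have hs: "((\<lambda>k. fcoef T f k * trig T k u) has_sum S u) UNIV" for u
    unfolding S_def
    by (rule has_sum_infsum, rule abs_summable_summable) (use summ in \<open>simp add: norm_mult\<close>)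
  have "uniform_limit UNIV (\<lambda>X u. \<Sum>k\<in>X. fcoef T f k * trig T k u) S (finite_subsets_at_top UNIV)"
    unfolding S_def[abs_def] by (rule Weierstrass_m_test_general[OF _ summ]) (simp add: norm_mult)
  then have "continuous_on UNIV S"
    by (rule uniform_limit_theorem[rotated]) (auto intro!: always_eventually continuous_intros)
  then have closed: "closed {u. S u = f u}"
    using cont by (intro closed_Collect_eq)
  have "S u = f u" if "u \<in> {0<..<T} - F" for u
    by (rule LIMSEQ_unique[OF has_sum_imp_symmetric_limit[OF hs]
          fourier_tendsto_at_differentiable[OF T c _ F(2)[OF that]]]) (use that in auto)
  then have sub: "{0<..<T} - F \<subseteq> {u. S u = f u}" by blast
  have S01: "S u = f u" if "u \<in> {0..T}" for u
  proof -
    have "u islimpt {0<..<T}"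
    proof -
      have "u = 0 \<or> u = T \<or> u \<in> {0<..<T}" using that by auto
      then show ?thesis
        by (elim disjE) (use T in \<open>auto intro: islimpt_greaterThanLessThan1 islimpt_greaterThanLessThan2
            interior_limit_point simp: interior_open\<close>)
    qed
    \<comment> \<open>Removing the finitely many exceptional points does not destroy a limit
      point.\<close>
    then have "u islimpt (F \<union> ({0<..<T} - F))"
      by (rule islimpt_subset) auto
    then have "u islimpt ({0<..<T} - F)"
      unfolding islimpt_Un_finite[OF F(1)] .
    then have "u islimpt {u. S u = f u}"
      using sub by (rule islimpt_subset)
    then show ?thesis
      using closed by (auto simp: closed_limpt)
  qed
  interpret f: periodic_fun_simple f T
    by unfold_locales (rule per)
  interpret S: periodic_fun_simple S T
    by unfold_locales (use T in \<open>simp add: S_def trig_add\<close>)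
  define n v where "n = \<lfloor>u / T\<rfloor>" and "v = u - of_int n * T"
  have "of_int n \<le> u / T" "u / T < of_int n + 1"
    unfolding n_def by linarith+
  then have "v \<in> {0..T}"
    using T by (auto simp: v_def field_simps)
  then have "S (v + of_int n * T) = f (v + of_int n * T)"
    using S01 by (simp add: f.plus_of_int S.plus_of_int)
  then show ?thesis
    using hs[of u] by (simp add: v_def)
qed

lemma smooth_admissable_fourier:
  assumes c: "c > 1" and \<theta>: "smooth_admissable c 1 \<theta>"
  shows "(\<lambda>k. norm (fourier_coeff (ln c) \<theta> k)) summable_on UNIV" (is ?A)
    and "((\<lambda>k. fourier_coeff (ln c) \<theta> k * trig (ln c) k u) has_sum of_real (\<theta> u)) UNIV" (is ?B)
proof -
  define T where "T = ln c"
  have T: "T > 0" using c by (simp add: T_def)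
  have per: "\<theta> (x + T) = \<theta> x" for x
    using \<theta> c by (simp add: smooth_admissable_def admissable_def T_def)
  have cont: "continuous_on UNIV \<theta>"
    using \<theta> by (simp add: smooth_admissable_def)
  have C1: "\<theta> piecewise_C1_differentiable_on {0..T}"
    and lim: "\<And>x. \<exists>l. (deriv \<theta> \<longlongrightarrow> l) (at_left x)" "\<And>x. \<exists>l. (deriv \<theta> \<longlongrightarrow> l) (at_right x)"
    using \<theta> by (auto simp: smooth_admissable_def piecewise_C1_def)
  obtain F D0 where F: "finite F" and D0: "\<And>x. x \<in> {0..T} - F \<Longrightarrow> (\<theta> has_vector_derivative D0 x) (at x)"
    and D0c: "continuous_on ({0..T} - F) D0"
    using C1 unfolding piecewise_C1_differentiable_on_def C1_differentiable_on_def by blast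
  \<comment> \<open>Continuity off \<open>F\<close> would allow \<open>D0\<close> to be unbounded
    near \<open>F\<close>; the one-sided limits of \<open>deriv \<theta>\<close> exclude
    this.\<close>
  obtain B where B: "\<And>y. y \<in> {0..T} \<Longrightarrow> \<bar>deriv \<theta> y\<bar> \<le> B"
    using deriv_bounded_interval[OF lim, of 0 T] T by (meson less_imp_le)
  have D0B: "\<bar>D0 x\<bar> \<le> B" if "x \<in> {0..T} - F" for x
    using D0[OF that] B[of x] that
    by (metis DERIV_imp_deriv DiffD1 has_real_derivative_iff_has_vector_derivative)
  \<comment> \<open>The value 0 at the exceptional points changes no integral and makes
    \<open>D\<close> bounded and measurable on the whole period.\<close>
  define D :: "real \<Rightarrow> complex" where "D x = (if x \<in> {0..T} - F then of_real (D0 x) else 0)" for x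
  have meas: "D \<in> borel_measurable (lebesgue_on {0..T})"
    unfolding D_def
  proof (rule measurable_restrict_space1, subst borel_measurable_if)
    have F': "{0..T} - F \<in> sets lebesgue"
      using negligible_imp_sets[OF negligible_finite[OF F]] by (intro sets.Diff) auto
    then show "{0..T} - F \<in> sets lebesgue" .
    show "(\<lambda>x. complex_of_real (D0 x)) \<in> borel_measurable (lebesgue_on ({0..T} - F))"
      using D0c F' by (intro continuous_imp_measurable_on_sets_lebesgue continuous_intros) auto
  qed
  have Db: "norm (D x) \<le> max 0 B" if "x \<in> {0..T}" for x
    using D0B[of x] that by (auto simp: D_def)
  have Dd: "((\<lambda>x. complex_of_real (\<theta> x)) has_vector_derivative D x) (at x)" if "x \<in> {0<..<T} - F" for x
    using has_vector_derivative_of_real[of \<theta> "D0 x" "at x", where 'a = complex] D0[of x] that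
    by (auto simp: D_def has_real_derivative_iff_has_vector_derivative)
  have per': "complex_of_real (\<theta> (x + T)) = of_real (\<theta> x)" for x by (simp add: per)
  have cont': "continuous_on X (\<lambda>x. complex_of_real (\<theta> x))" for X
    using cont by (intro continuous_intros) (rule continuous_on_subset, auto)
  show ?B
    using fourier_series[OF T per' cont' F Dd meas Db, of u] by (simp add: T_def fourier_coeff_eq_fcoef)
  show ?A
    using fcoef_abs_summable[OF T _ cont' F Dd meas Db] per'[of 0] by (simp add: T_def fourier_coeff_eq_fcoef)
qed

section \<open>Mellin transforms of exponentials\<close>

lemma powr_measurable_Ioi [measurable]:
  "(\<lambda>t. indicator {0<..} t *\<^sub>R (complex_of_real t powr s)) \<in> borel_measurable borel"
  by (rule borel_measurable_continuous_on_indicator) (auto intro!: continuous_intros simp: complex_nonpos_Reals_iff)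

lemma powr_mult_measurable_Ioi:
  assumes "g \<in> borel_measurable borel"
  shows "(\<lambda>t. indicator {0<..} t *\<^sub>R (complex_of_real t powr s * g t)) \<in> borel_measurable lborel"
proof -
  note assms [measurable]
  have "(\<lambda>t. (indicator {0<..} t *\<^sub>R (complex_of_real t powr s)) * g t) \<in> borel_measurable borel"
    by measurable
  then show ?thesis by simp
qed

lemma norm_of_real_powr: "t > 0 \<Longrightarrow> norm (complex_of_real t powr s) = t powr Re s"
  by (simp add: norm_powr_real_powr)

text \<open>Euler's integral is available for the completed Lebesgue measure; Borel measurability of
  the integrand moves it to \<open>lborel\<close>, where substitution and dominated convergence are
  applied.\<close>

lemma Gamma_integral_lborel:
  assumes s: "Re s > 0"
  shows "set_integrable lborel {0<..} (\<lambda>t. complex_of_real t powr (s - 1) * exp (- of_real t))"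
    and "(LBINT t:{0<..}. complex_of_real t powr (s - 1) * exp (- of_real t)) = Gamma s"
proof -
  define f where "f = (\<lambda>t. complex_of_real t powr (s - 1) * exp (- of_real t))"
  have feq: "f = (\<lambda>t. complex_of_real t powr (s - 1) / of_real (exp t))"
    by (simp add: f_def exp_minus divide_inverse fun_eq_iff flip: exp_of_real)
  have "f absolutely_integrable_on {0<..}"
    unfolding feq by (rule absolutely_integrable_Gamma_integral'[OF s])
  moreover have meas: "(\<lambda>t. indicator {0<..} t *\<^sub>R f t) \<in> borel_measurable lborel"
    unfolding f_def by (rule powr_mult_measurable_Ioi) measurable
  ultimately have int: "set_integrable lborel {0<..} f"
    unfolding set_integrable_def by (simp add: integrable_completion)
  have "(f has_integral Gamma s) {0<..}"
    unfolding feq using Gamma_integral_complex'[OF s] .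
  then have "integral {0<..} f = Gamma s"
    by (rule integral_unique)
  then have "(LBINT t:{0<..}. f t) = Gamma s"
    using set_borel_integral_eq_integral(2)[OF int] by simp
  with int show "set_integrable lborel {0<..} (\<lambda>t. complex_of_real t powr (s - 1) * exp (- of_real t))"
    "(LBINT t:{0<..}. complex_of_real t powr (s - 1) * exp (- of_real t)) = Gamma s"
    by (simp_all add: f_def)
qed

text \<open>A substitution by a positive factor, which comes out of a complex power without meeting
  the branch cut.\<close>

lemma powr_exp_integral_real:
  assumes s: "Re s > 0" and a: "a > 0"
  shows "set_integrable lborel {0<..} (\<lambda>t. complex_of_real t powr (s - 1) * exp (- (of_real a * of_real t)))"
    and "(LBINT t:{0<..}. complex_of_real t powr (s - 1) * exp (- (of_real a * of_real t))) =
       Gamma s * of_real a powr (- s)"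
proof -
  define f where "f = (\<lambda>t. complex_of_real t powr (s - 1) * exp (- (of_real a * of_real t)))"
  define h where "h = (\<lambda>t. indicator {0<..} t *\<^sub>R (complex_of_real t powr (s - 1) * exp (- of_real t)))"
  have h: "h (0 + a * t) = of_real a powr (s - 1) * (indicator {0<..} t *\<^sub>R f t)" for t
    using a by (cases "t > 0")
      (auto simp: h_def f_def indicator_def zero_less_mult_iff powr_times_real_left)
  have a1: "of_real a powr (s - 1) \<noteq> 0" using a by simp
  have "integrable lborel (\<lambda>t. h (0 + a * t))"
    using lborel_integrable_real_affine[of h a 0] Gamma_integral_lborel(1)[OF s] a
    by (simp add: h_def set_integrable_def)
  then have "integrable lborel (\<lambda>t. inverse (of_real a powr (s - 1)) * h (0 + a * t))"
    by auto
  then have int: "integrable lborel (\<lambda>t. indicator {0<..} t *\<^sub>R f t)"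
    unfolding h using a1 by (simp del: mult_scaleR_right flip: mult.assoc)
  have "Gamma s = (\<integral>t. h t \<partial>lborel)"
    using Gamma_integral_lborel(2)[OF s] by (simp add: h_def set_lebesgue_integral_def)
  also have "\<dots> = \<bar>a\<bar> *\<^sub>R (\<integral>t. h (0 + a * t) \<partial>lborel)"
    using a by (intro lborel_integral_real_affine) auto
  also have "\<dots> = of_real a * of_real a powr (s - 1) * (LBINT t:{0<..}. f t)"
    unfolding h using a by (simp add: set_lebesgue_integral_def scaleR_conv_of_real)
  also have "of_real a * of_real a powr (s - 1) = complex_of_real a powr s"
    using a by (simp add: powr_diff)
  finally have "(LBINT t:{0<..}. f t) = Gamma s * of_real a powr (- s)"
    using a by (simp add: powr_minus field_simps)
  with int show "set_integrable lborel {0<..} (\<lambda>t. complex_of_real t powr (s - 1) * exp (- (of_real a * of_real t)))"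
    "(LBINT t:{0<..}. complex_of_real t powr (s - 1) * exp (- (of_real a * of_real t))) = Gamma s * of_real a powr (- s)"
    by (simp_all add: f_def set_integrable_def)
qed

lemma norm_exp_partial_sum_le: "norm (\<Sum>k<n. w ^ k / fact k) \<le> exp (norm (w :: complex))"
proof -
  have "norm (\<Sum>k<n. w ^ k / fact k) \<le> (\<Sum>k<n. norm w ^ k /\<^sub>R fact k)"
    by (rule order.trans[OF norm_sum]) (simp add: norm_divide norm_mult norm_power norm_inverse divide_inverse mult.commute)
  also have "\<dots> \<le> (\<Sum>k. norm w ^ k /\<^sub>R fact k)"
    by (rule sum_le_suminf[OF summable_exp_generic]) auto
  finally show ?thesis by (simp add: exp_def)
qed

(* The exponential is expanded around a real point a with norm (z - a) < a, which exists for every z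
   in the right half-plane. *)
lemma powr_exp_integral:
  assumes s: "Re s > 0" and z: "Re z > 0"
  shows "set_integrable lborel {0<..} (\<lambda>t. complex_of_real t powr (s - 1) * exp (- (z * of_real t)))"
    and "(LBINT t:{0<..}. complex_of_real t powr (s - 1) * exp (- (z * of_real t))) = Gamma s * z powr (- s)"
proof -
  \<comment> \<open>Chosen so that \<open>a * Re z = |z|^2\<close>; then
    \<open>|a - z|^2 = a^2 - 2 a Re z + |z|^2 = a^2 - |z|^2\<close>, which is less than
    \<open>a^2\<close>.\<close>
  define a where "a = (norm z)\<^sup>2 / Re z"
  have z0: "norm z > 0" using z by auto
  then have a: "a > 0" using z by (simp add: a_def)
  define r where "r = norm (of_real a - z)"
  have "r\<^sup>2 = a\<^sup>2 - 2 * (a * Re z) + (norm z)\<^sup>2"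
    by (simp add: r_def cmod_power2 power2_diff)
  also have "a * Re z = (norm z)\<^sup>2" using z by (simp add: a_def)
  finally have "r\<^sup>2 < a\<^sup>2" using z0 by simp
  then have ra: "r < a" using a by (simp add: power2_less_imp_less)
  define F where "F n t = indicator {0<..} t *\<^sub>R (complex_of_real t powr (s - 1) * exp (- (of_real a * of_real t)) *
      (\<Sum>k<n. ((of_real a - z) * of_real t) ^ k / fact k))" for n :: nat and t
  define f where "f t = indicator {0<..} t *\<^sub>R (complex_of_real t powr (s - 1) * exp (- (z * of_real t)))" for t
  \<comment> \<open>The partial sums of \<open>exp ((a - z) t)\<close> are at most
    \<open>exp (r t)\<close> in modulus, so \<open>r < a\<close> leaves a decaying exponential as
    majorant.\<close>
  define g where "g t = norm (indicator {0<..} t *\<^sub>R (complex_of_real t powr (s - 1) * exp (- (of_real (a - r) * of_real t))))" for t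
  have g: "integrable lborel g"
    unfolding g_def using powr_exp_integral_real(1)[OF s, of "a - r"] ra unfolding set_integrable_def
    by (intro integrable_norm) auto
  have fm: "f \<in> borel_measurable lborel"
    unfolding f_def[abs_def] by (rule powr_mult_measurable_Ioi) measurable
  have Fm: "F n \<in> borel_measurable lborel" for n
    unfolding F_def[abs_def] mult.assoc by (rule powr_mult_measurable_Ioi) measurable
  have lim: "AE t in lborel. (\<lambda>n. F n t) \<longlonglongrightarrow> f t"
  proof (rule AE_I2)
    fix t
    have "(\<lambda>k. ((of_real a - z) * of_real t) ^ k /\<^sub>R fact k) sums exp ((of_real a - z) * of_real t)"
      by (rule exp_converges)
    then have "(\<lambda>n. \<Sum>k<n. ((of_real a - z) * of_real t) ^ k / fact k) \<longlonglongrightarrow> exp ((of_real a - z) * of_real t)"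
      by (simp add: sums_def scaleR_conv_of_real divide_inverse mult.commute)
    then have "(\<lambda>n. F n t) \<longlonglongrightarrow> indicator {0<..} t *\<^sub>R (complex_of_real t powr (s - 1) * exp (- (of_real a * of_real t)) *
      exp ((of_real a - z) * of_real t))"
      unfolding F_def by (intro tendsto_intros)
    also have "indicator {0<..} t *\<^sub>R (complex_of_real t powr (s - 1) * exp (- (of_real a * of_real t)) *
      exp ((of_real a - z) * of_real t)) = f t"
      by (simp add: f_def mult.assoc exp_add[symmetric] algebra_simps)
    finally show "(\<lambda>n. F n t) \<longlonglongrightarrow> f t" .
  qed
  have bound: "AE t in lborel. norm (F n t) \<le> g t" for n
  proof (rule AE_I2)
    fix t
    show "norm (F n t) \<le> g t"
    proof (cases "t > 0")
      case True
      have "norm (\<Sum>k<n. ((of_real a - z) * of_real t) ^ k / fact k) \<le> exp (norm ((of_real a - z) * of_real t))"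
        by (rule norm_exp_partial_sum_le)
      also have "\<dots> = exp (r * t)" using True by (simp add: norm_mult r_def)
      finally have "norm (F n t) \<le> t powr (Re s - 1) * exp (- (a * t)) * exp (r * t)"
        using True by (simp add: F_def norm_mult norm_of_real_powr)
      also have "\<dots> = g t"
        using True by (simp add: g_def norm_mult norm_of_real_powr mult.assoc exp_add[symmetric] algebra_simps)
      finally show ?thesis .
    qed (simp add: F_def g_def)
  qed
  have conv: "(\<lambda>n. \<integral>t. F n t \<partial>lborel) \<longlonglongrightarrow> (\<integral>t. f t \<partial>lborel)"
    by (rule integral_dominated_convergence[OF fm Fm g lim bound])
  have fi: "integrable lborel f"
    by (rule integrable_dominated_convergence[OF fm Fm g lim bound])
  have sk: "Re (s + of_nat k) > 0" for k using s by simp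
  have s0: "s \<notin> \<int>\<^sub>\<le>\<^sub>0" using s by (auto elim!: nonpos_Ints_cases)
  have Fi: "(\<integral>t. F n t \<partial>lborel) = (\<Sum>k<n. (of_real a - z) ^ k / fact k * (Gamma (s + of_nat k) * of_real a powr (- (s + of_nat k))))" for n
  proof -
    define G where "G k t = indicator {0<..} t *\<^sub>R (complex_of_real t powr (s + of_nat k - 1) * exp (- (of_real a * of_real t)))" for k t
    have "F n t = (\<Sum>k<n. (of_real a - z) ^ k / fact k * G k t)" for t
    proof (cases "t > 0")
      case True
      have "complex_of_real t powr (s + of_nat k - 1) = complex_of_real t powr (s - 1) * of_real t ^ k" for k
      proof -
        have "complex_of_real t powr (s + of_nat k - 1) = complex_of_real t powr ((s - 1) + of_nat k)"
          by (simp add: algebra_simps)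
        also have "\<dots> = complex_of_real t powr (s - 1) * of_real t powr (of_nat k)"
          by (rule powr_add)
        also have "of_real t powr (of_nat k) = complex_of_real t ^ k"
          using True by (intro powr_complexpow) auto
        finally show ?thesis .
      qed
      then show ?thesis using True
        by (simp add: F_def G_def sum_distrib_left power_mult_distrib mult_ac)
    qed (simp add: F_def G_def)
    then have "F n = (\<lambda>t. \<Sum>k<n. (of_real a - z) ^ k / fact k * G k t)" by (rule ext)
    moreover have "integrable lborel (G k)" for k
      using powr_exp_integral_real(1)[OF sk a] by (simp add: G_def[abs_def] set_integrable_def)
    moreover have "(\<integral>t. G k t \<partial>lborel) = Gamma (s + of_nat k) * of_real a powr (- (s + of_nat k))" for k
      using powr_exp_integral_real(2)[OF sk a] by (simp add: G_def set_lebesgue_integral_def)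
    ultimately show ?thesis by simp
  qed
  \<comment> \<open>From \<open>Gamma (s + k) = pochhammer s k * Gamma s\<close>, the termwise
    integrals are those of the binomial series of \<open>(z / a) powr (- s)\<close> in powers of
    \<open>z / a - 1\<close>. Its convergence is again the condition \<open>r < a\<close>.\<close>
  have coeff: "(of_real a - z) ^ k / fact k * (Gamma (s + of_nat k) * of_real a powr (- (s + of_nat k))) =
    Gamma s * of_real a powr (- s) * (((- s) gchoose k) * (z / of_real a - 1) ^ k)" for k
  proof -
    have "Gamma (s + of_nat k) = pochhammer s k * Gamma s"
      using pochhammer_Gamma[OF s0, of k] s0 by (simp add: Gamma_eq_zero_iff)
    moreover have "complex_of_real a powr (- (s + of_nat k)) = of_real a powr (- s) / of_real a ^ k"
    proof -
      have "complex_of_real a powr (- (s + of_nat k)) = of_real a powr (- s - of_nat k)" by simp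
      also have "\<dots> = of_real a powr (- s) / of_real a powr (of_nat k)"
        by (rule powr_diff)
      also have "of_real a powr (of_nat k) = complex_of_real a ^ k"
        using a by (intro powr_complexpow) auto
      finally show ?thesis .
    qed
    moreover have "(z / of_real a - 1) ^ k = (- 1) ^ k * (of_real a - z) ^ k / of_real a ^ k"
    proof -
      have "z / of_real a - 1 = - 1 * (of_real a - z) / of_real a" using a by (simp add: field_simps)
      then show ?thesis by (simp only: power_mult_distrib power_divide)
    qed
    ultimately show ?thesis
      by (simp add: gbinomial_pochhammer mult_ac flip: power_mult_distrib)
  qed
  have "norm (z / of_real a - 1) = r / a"
  proof -
    have "z / of_real a - 1 = - (of_real a - z) / of_real a" using a by (simp add: field_simps)
    then show ?thesis using a by (simp add: r_def norm_divide norm_minus_commute)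
  qed
  then have "norm (z / of_real a - 1) < 1" using ra a by simp
  then have "(\<lambda>k. ((- s) gchoose k) * (z / of_real a - 1) ^ k) sums (1 + (z / of_real a - 1)) powr (- s)"
    by (rule gen_binomial_complex)
  then have "(\<lambda>k. Gamma s * of_real a powr (- s) * (((- s) gchoose k) * (z / of_real a - 1) ^ k)) sums
      (Gamma s * of_real a powr (- s) * (z / of_real a) powr (- s))"
    using sums_mult[of _ _ "Gamma s * of_real a powr (- s)"] by simp
  then have "(\<lambda>n. \<integral>t. F n t \<partial>lborel) \<longlonglongrightarrow> Gamma s * of_real a powr (- s) * (z / of_real a) powr (- s)"
    unfolding Fi coeff sums_def .
  then have "(\<integral>t. f t \<partial>lborel) = Gamma s * of_real a powr (- s) * (z / of_real a) powr (- s)"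
    using conv LIMSEQ_unique by blast
  also have "\<dots> = Gamma s * z powr (- s)"
    using powr_times_real_left[of "of_real a" "z / of_real a" "- s"] a by (simp add: mult.assoc)
  finally show "(LBINT t:{0<..}. complex_of_real t powr (s - 1) * exp (- (z * of_real t))) = Gamma s * z powr (- s)"
    by (simp add: f_def set_lebesgue_integral_def)
  show "set_integrable lborel {0<..} (\<lambda>t. complex_of_real t powr (s - 1) * exp (- (z * of_real t)))"
    using fi by (simp add: f_def[abs_def] set_integrable_def)
qed

text \<open>Mean value inequality for \<open>exp\<close> on a half-plane containing both exponents.
  The factor \<open>t\<close> cancels the singularity \<open>1 / t\<close> of the Mellin kernel on
  the imaginary axis.\<close>

lemma norm_exp_diff_le:
  assumes z: "Re z > 0" and t: "t \<ge> 0"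
  shows "norm (exp (- (z * of_real t)) - exp (- of_real t)) \<le> norm (z - 1) * (t * exp (- (min (Re z) 1 * t)))"
proof -
  define m where "m = min (Re z) 1"
  define S where "S = {w. Re w \<le> - (m * t)}"
  have "norm (exp (- (z * of_real t)) - exp (- of_real t)) \<le> exp (- (m * t)) * norm (- (z * of_real t) - (- of_real t))"
  proof (rule field_differentiable_bound[where S = S and f' = exp])
    show "convex S" unfolding S_def by (rule convex_halfspace_Re_le)
    show "(exp has_field_derivative exp w) (at w within S)" for w :: complex
      by (rule DERIV_exp[THEN has_field_derivative_at_within])
    show "norm (exp w) \<le> exp (- (m * t))" if "w \<in> S" for w
      using that by (simp add: S_def)
    have "m * t \<le> Re z * t" "m * t \<le> 1 * t"
      using t by (intro mult_right_mono; simp add: m_def)+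
    then show "- (z * of_real t) \<in> S" "- of_real t \<in> S"
      by (simp_all add: S_def)
  qed
  also have "- (z * of_real t) - (- of_real t) = - ((z - 1) * of_real t)"
    by (simp add: algebra_simps)
  finally show ?thesis
    using t by (simp add: norm_mult m_def mult_ac)
qed

section \<open>Mellin transforms on the imaginary axis and the size of Gamma there\<close>

lemma exp_poly_integrable:
  fixes m :: real
  assumes m: "m > 0"
  shows "integrable lborel (\<lambda>t. indicator {0<..} t * ((1 + t) * exp (- (m * t))))"
proof -
  have 1: "integrable lborel (\<lambda>t. norm (indicator {0<..} t *\<^sub>R (complex_of_real t powr (1 - 1) * exp (- (of_real m * of_real t)))))"
    using powr_exp_integral_real(1)[of 1, OF _ m] unfolding set_integrable_def by (intro integrable_norm) simp
  have 2: "integrable lborel (\<lambda>t. norm (indicator {0<..} t *\<^sub>R (complex_of_real t powr (2 - 1) * exp (- (of_real m * of_real t)))))"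
    using powr_exp_integral_real(1)[of 2, OF _ m] unfolding set_integrable_def by (intro integrable_norm) simp
  have "integrable lborel (\<lambda>t. norm (indicator {0<..} t *\<^sub>R (complex_of_real t powr (1 - 1) * exp (- (of_real m * of_real t))))
     + norm (indicator {0<..} t *\<^sub>R (complex_of_real t powr (2 - 1) * exp (- (of_real m * of_real t)))))"
    by (rule Bochner_Integration.integrable_add[OF 1 2])
  then show ?thesis
    by (rule Bochner_Integration.integrable_cong[THEN iffD1, rotated 2])
      (auto simp: indicator_def norm_mult algebra_simps)
qed

(* Both cases are limits of the formula for the exponents of positive real part; for the exponent 0 the
   pole of Gamma turns the difference of powers into the derivative of the power function. *)
lemma powr_exp_diff_integral:
  fixes w :: real
  assumes z: "Re z > 0"
  shows "set_integrable lborel {0<..} (\<lambda>t. complex_of_real t powr (\<i> * of_real w - 1) * (exp (- (z * of_real t)) - exp (- of_real t)))"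
    and "(LBINT t:{0<..}. complex_of_real t powr (\<i> * of_real w - 1) * (exp (- (z * of_real t)) - exp (- of_real t))) =
       (if w = 0 then - Ln z else Gamma (\<i> * of_real w) * (z powr (- (\<i> * of_real w)) - 1))"
proof -
  define m where "m = min (Re z) 1"
  have m: "m > 0" using z by (simp add: m_def)
  define E where "E t = exp (- (z * of_real t)) - exp (- of_real t)" for t :: real
  have Em: "E \<in> borel_measurable borel"
    unfolding E_def by measurable
  define e where "e n = 1 / (of_nat (Suc n) :: real)" for n
  have e: "0 < e n" "e n \<le> 1" for n by (auto simp: e_def)
  have e0: "e \<longlonglongrightarrow> 0"
    unfolding e_def by (rule LIMSEQ_Suc[OF lim_1_over_n])
  define s where "s n = complex_of_real (e n) + \<i> * of_real w" for n
  have Re_s: "Re (s n) = e n" for n by (simp add: s_def)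
  have s_lim: "s \<longlonglongrightarrow> \<i> * of_real w"
    unfolding s_def using tendsto_add[OF tendsto_of_real[OF e0] tendsto_const] by simp
  define F where "F n t = indicator {0<..} t *\<^sub>R (complex_of_real t powr (s n - 1) * E t)" for n t
  define f where "f t = indicator {0<..} t *\<^sub>R (complex_of_real t powr (\<i> * of_real w - 1) * E t)" for t
  define g where "g t = norm (z - 1) * (indicator {0<..} t * ((1 + t) * exp (- (m * t))))" for t
  have g: "integrable lborel g"
    unfolding g_def using exp_poly_integrable[OF m] by auto
  have fm: "f \<in> borel_measurable lborel"
    unfolding f_def[abs_def] by (rule powr_mult_measurable_Ioi[OF Em])
  have Fm: "F n \<in> borel_measurable lborel" for n
    unfolding F_def[abs_def] by (rule powr_mult_measurable_Ioi[OF Em])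
  have lim: "AE t in lborel. (\<lambda>n. F n t) \<longlonglongrightarrow> f t"
  proof (rule AE_I2)
    fix t :: real
    show "(\<lambda>n. F n t) \<longlonglongrightarrow> f t"
    proof (cases "t > 0")
      case True
      then have "(\<lambda>n. complex_of_real t powr (s n - 1)) \<longlonglongrightarrow> complex_of_real t powr (\<i> * of_real w - 1)"
        by (intro tendsto_powr_complex tendsto_const tendsto_diff s_lim) (auto simp: complex_nonpos_Reals_iff)
      then show ?thesis
        unfolding F_def f_def by (intro tendsto_scaleR tendsto_mult tendsto_const)
    qed (simp add: F_def f_def)
  qed
  have bound: "AE t in lborel. norm (F n t) \<le> g t" for n
  proof (rule AE_I2)
    fix t
    show "norm (F n t) \<le> g t"
    proof (cases "t > 0")
      case True
      \<comment> \<open>The power is at most 1 for \<open>t \<le> 1\<close> and at most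
        \<open>t\<close> beyond, since \<open>e n\<close> lies between 0 and 1; this makes the
        majorant independent of \<open>n\<close>.\<close>
      have "t powr e n \<le> 1 + t"
      proof (cases "t \<le> 1")
        case True
        then show ?thesis using \<open>t > 0\<close> e[of n] powr_mono2[of "e n" t 1] by simp
      next
        case False
        then show ?thesis using e[of n] powr_mono[of "e n" 1 t] by simp
      qed
      then have p: "t powr (e n - 1) * t \<le> 1 + t"
        using True by (simp add: powr_diff)
      have "norm (F n t) = t powr (e n - 1) * norm (E t)"
        using True by (simp add: F_def norm_mult norm_of_real_powr Re_s)
      also have "\<dots> \<le> t powr (e n - 1) * (norm (z - 1) * (t * exp (- (m * t))))"
        using norm_exp_diff_le[OF z, of t] True by (intro mult_left_mono) (auto simp: E_def m_def)
      also have "\<dots> = (t powr (e n - 1) * t) * (norm (z - 1) * exp (- (m * t)))"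
        by simp
      also have "\<dots> \<le> (1 + t) * (norm (z - 1) * exp (- (m * t)))"
        using p by (intro mult_right_mono) auto
      also have "\<dots> = g t"
        using True by (simp add: g_def)
      finally show ?thesis .
    qed (simp add: F_def g_def)
  qed
  have conv: "(\<lambda>n. \<integral>t. F n t \<partial>lborel) \<longlonglongrightarrow> (\<integral>t. f t \<partial>lborel)"
    by (rule integral_dominated_convergence[OF fm Fm g lim bound])
  have fi: "integrable lborel f"
    by (rule integrable_dominated_convergence[OF fm Fm g lim bound])
  have Fi: "(\<integral>t. F n t \<partial>lborel) = Gamma (s n) * (z powr (- s n) - 1)" for n
  proof -
    have s: "Re (s n) > 0" using e by (simp add: Re_s)
    note 1 = powr_exp_integral[OF s z] and 2 = powr_exp_integral[OF s, of 1]
    have "(LBINT t:{0<..}. complex_of_real t powr (s n - 1) * exp (- (z * of_real t)) - complex_of_real t powr (s n - 1) * exp (- (1 * of_real t)))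
      = Gamma (s n) * z powr (- s n) - Gamma (s n) * 1 powr (- s n)"
      using set_integral_diff(2)[OF 1(1) 2(1)] 1(2) 2(2) by simp
    then show ?thesis
      by (simp add: F_def[abs_def] E_def set_lebesgue_integral_def algebra_simps)
  qed
  have z0: "z \<noteq> 0" using z by auto
  have "(\<lambda>n. Gamma (s n) * (z powr (- s n) - 1)) \<longlonglongrightarrow>
     (if w = 0 then - Ln z else Gamma (\<i> * of_real w) * (z powr (- (\<i> * of_real w)) - 1))"
  proof (cases "w = 0")
    case True
    have sn: "s n = of_real (e n)" for n by (simp add: s_def True)
    have G: "Gamma (s n) * (z powr (- s n) - 1) = Gamma (s n + 1) * ((z powr (- s n) - 1) / s n)" for n
    proof -
      have "s n \<notin> \<int>\<^sub>\<le>\<^sub>0" using e[of n] by (auto simp: sn elim!: nonpos_Ints_cases dest!: arg_cong[where f = Re])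
      then have "Gamma (s n + 1) = s n * Gamma (s n)" by (rule Gamma_plus1)
      then show ?thesis using e[of n] by (simp add: sn)
    qed
    have "((\<lambda>h. exp (- h * Ln z)) has_field_derivative - Ln z) (at 0)"
      by (auto intro!: derivative_eq_intros)
    then have "((\<lambda>h. (exp (- h * Ln z) - 1) / h) \<longlongrightarrow> - Ln z) (at 0)"
      by (simp add: has_field_derivative_iff)
    moreover have "filterlim s (at 0) sequentially"
      unfolding filterlim_at using s_lim True e(1) by (auto simp: sn less_imp_neq[symmetric])
    ultimately have "(\<lambda>n. (exp (- s n * Ln z) - 1) / s n) \<longlonglongrightarrow> - Ln z"
      by (rule filterlim_compose)
    moreover have "(\<lambda>n. Gamma (s n + 1)) \<longlonglongrightarrow> Gamma (0 + 1)"
      using s_lim True by (intro tendsto_Gamma tendsto_add tendsto_const) auto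
    ultimately have "(\<lambda>n. Gamma (s n + 1) * ((exp (- s n * Ln z) - 1) / s n)) \<longlonglongrightarrow> Gamma (0 + 1) * (- Ln z)"
      by (intro tendsto_mult)
    then show ?thesis
      unfolding G using True z0 by (simp add: powr_def)
  next
    case False
    have "\<i> * of_real w \<notin> \<int>\<^sub>\<le>\<^sub>0"
      using False by (auto elim!: nonpos_Ints_cases simp: complex_eq_iff)
    then show ?thesis
      using False z0 by (auto intro!: tendsto_intros tendsto_Gamma s_lim tendsto_powr_complex_0 simp: powr_def)
  qed
  then have "(\<integral>t. f t \<partial>lborel) = (if w = 0 then - Ln z else Gamma (\<i> * of_real w) * (z powr (- (\<i> * of_real w)) - 1))"
    using conv unfolding Fi by (rule LIMSEQ_unique[rotated])
  then show "(LBINT t:{0<..}. complex_of_real t powr (\<i> * of_real w - 1) * (exp (- (z * of_real t)) - exp (- of_real t))) =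
       (if w = 0 then - Ln z else Gamma (\<i> * of_real w) * (z powr (- (\<i> * of_real w)) - 1))"
    by (simp add: f_def set_lebesgue_integral_def E_def)
  show "set_integrable lborel {0<..} (\<lambda>t. complex_of_real t powr (\<i> * of_real w - 1) * (exp (- (z * of_real t)) - exp (- of_real t)))"
    using fi by (simp add: f_def[abs_def] set_integrable_def E_def)
qed

text \<open>Since \<open>Gamma (1 - i w) = - i w * cnj (Gamma (i w))\<close>, the reflection formula
  yields \<open>|Gamma (i w)|^2 = pi / (|w| sinh (pi |w|))\<close>. Multiplied by
  \<open>exp (pi |w|)\<close> this is decreasing in \<open>|w|\<close>, hence bounded by its value
  at \<open>a\<close>.\<close>

lemma norm_Gamma_imaginary_le:
  fixes a w :: real
  assumes a: "a > 0" and w: "\<bar>w\<bar> \<ge> a"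
  shows "(norm (Gamma (\<i> * of_real w)))\<^sup>2 * exp (pi * \<bar>w\<bar>) \<le> 2 * pi / (a * (1 - exp (- (2 * pi * a))))"
proof -
  define G where "G = norm (Gamma (\<i> * of_real w))"
  have w0: "w \<noteq> 0" using assms by auto
  have "- (\<i> * of_real w) \<notin> \<int>\<^sub>\<le>\<^sub>0"
    using w0 by (auto elim!: nonpos_Ints_cases simp: complex_eq_iff)
  then have "Gamma (- (\<i> * of_real w) + 1) = - (\<i> * of_real w) * Gamma (- (\<i> * of_real w))"
    by (rule Gamma_plus1)
  moreover have "Gamma (- (\<i> * of_real w)) = cnj (Gamma (\<i> * of_real w))"
    by (simp add: cnj_Gamma)
  ultimately have "norm (Gamma (1 - \<i> * of_real w)) = \<bar>w\<bar> * G"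
    by (simp add: G_def norm_mult)
  then have "G * (\<bar>w\<bar> * G) = norm (Gamma (\<i> * of_real w) * Gamma (1 - \<i> * of_real w))"
    by (simp add: G_def norm_mult)
  also have "\<dots> = norm (of_real pi / sin (of_real pi * (\<i> * of_real w)))"
    by (simp only: Gamma_reflection_complex)
  also have "of_real pi * (\<i> * of_real w) = \<i> * of_real (pi * w)" by simp
  also have "norm (of_real pi / sin (\<i> * of_real (pi * w))) = 2 * pi / \<bar>exp (pi * w) - exp (- (pi * w))\<bar>"
  proof -
    have "sin (\<i> * of_real (pi * w)) = \<i> * of_real ((exp (pi * w) - exp (- (pi * w))) / 2)"
      by (simp add: sin_i_times exp_minus flip: exp_of_real)
    then have "norm (sin (\<i> * of_real (pi * w))) = \<bar>exp (pi * w) - exp (- (pi * w))\<bar> / 2"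
      by (simp only: norm_mult norm_of_real) simp
    then show ?thesis by (simp only: norm_divide norm_of_real) simp
  qed
  also have "\<bar>exp (pi * w) - exp (- (pi * w))\<bar> = exp (pi * \<bar>w\<bar>) - exp (- (pi * \<bar>w\<bar>))"
  proof (cases "w \<ge> 0")
    case True
    then have "0 \<le> pi * w" by simp
    then show ?thesis using True by simp
  next
    case False
    then have "pi * w < 0" by (simp add: mult_pos_neg)
    then show ?thesis using False by simp
  qed
  finally have "G\<^sup>2 * \<bar>w\<bar> = 2 * pi / (exp (pi * \<bar>w\<bar>) - exp (- (pi * \<bar>w\<bar>)))"
    by (simp add: power2_eq_square mult_ac)
  then have "G\<^sup>2 = 2 * pi / ((exp (pi * \<bar>w\<bar>) - exp (- (pi * \<bar>w\<bar>))) * \<bar>w\<bar>)"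
    using w0 by (simp add: field_simps)
  moreover have "exp (pi * \<bar>w\<bar>) - exp (- (pi * \<bar>w\<bar>)) = exp (pi * \<bar>w\<bar>) * (1 - exp (- (2 * pi * \<bar>w\<bar>)))"
    by (simp add: algebra_simps flip: exp_add)
  ultimately have "G\<^sup>2 * exp (pi * \<bar>w\<bar>) = 2 * pi / (\<bar>w\<bar> * (1 - exp (- (2 * pi * \<bar>w\<bar>))))"
    by simp
  also have "\<dots> \<le> 2 * pi / (a * (1 - exp (- (2 * pi * a))))"
    using a w by (intro divide_left_mono mult_mono mult_pos_pos) auto
  finally show ?thesis by (simp add: G_def)
qed

section \<open>Integration against a measure with given tail\<close>

context
  fixes \<phi> :: "real measure" and \<Phi> :: "real \<Rightarrow> real"
  assumes sets_\<phi>: "sets \<phi> = sets (restrict_space borel {0<..})"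
    and tail: "\<And>r. r > 0 \<Longrightarrow> emeasure \<phi> {r<..} = ennreal (\<Phi> r)"
    and \<Phi>_nonneg: "\<And>r. r > 0 \<Longrightarrow> 0 \<le> \<Phi> r"
begin

lemma space_tail_measure: "space \<phi> = {0<..}"
  using sets_eq_imp_space_eq[OF sets_\<phi>] by (simp add: space_restrict_space)

lemma tail_sets: "r > 0 \<Longrightarrow> {r<..} \<in> sets \<phi>"
  unfolding sets_\<phi> by (subst sets_restrict_space_iff) auto

lemma tail_measurable_id: "(\<lambda>y. y) \<in> borel_measurable \<phi>"
  unfolding measurable_cong_sets[OF sets_\<phi> refl] by (rule measurable_restrict_space1) simp

text \<open>Infinite mass may accumulate at 0, but the tails beyond \<open>1 / Suc n\<close> have
  finite measure and exhaust the half-line. Fubini's theorem rests on this.\<close>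

lemma sigma_finite_tail: "sigma_finite_measure \<phi>"
proof
  let ?A = "range (\<lambda>n. {1 / real (Suc n)<..})"
  have "\<Union> ?A = {0<..}"
  proof (intro equalityI subsetI)
    fix y :: real assume "y \<in> {0<..}"
    then obtain n where "1 / real (Suc n) < y"
      using nat_approx_posE by auto
    then show "y \<in> \<Union> ?A" by auto
  next
    fix y :: real assume "y \<in> \<Union> ?A"
    then obtain n where n: "1 / real (Suc n) < y" by auto
    have "0 < 1 / real (Suc n)" by simp
    then show "y \<in> {0<..}" using n by (simp only: greaterThan_iff)
  qed
  then show "\<exists>A. countable A \<and> A \<subseteq> sets \<phi> \<and> \<Union> A = space \<phi> \<and> (\<forall>a\<in>A. emeasure \<phi> a \<noteq> \<infinity>)"
    by (intro exI[of _ ?A]) (auto simp: space_tail_measure tail_sets tail)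
qed

text \<open>Fubini on the region \<open>0 < t < y\<close>: integrating over \<open>y\<close> first
  leaves the measure of the tail beyond \<open>t\<close>. This is integration by parts without
  boundary terms.\<close>

lemma layer_cake:
  fixes H :: "real \<Rightarrow> complex"
  assumes Hm [measurable]: "H \<in> borel_measurable borel"
    and Hi: "set_integrable lborel {0<..} (\<lambda>t. of_real (\<Phi> t) * H t)"
  shows "integrable \<phi> (\<lambda>y. LBINT t:{0<..<y}. H t)"
    and "(\<integral>y. (LBINT t:{0<..<y}. H t) \<partial>\<phi>) = (LBINT t:{0<..}. of_real (\<Phi> t) * H t)"
proof -
  interpret sigma_finite_measure \<phi> by (rule sigma_finite_tail)
  interpret pair_sigma_finite lborel \<phi> ..
  define f where "f t y = (if 0 < t \<and> t < y then H t else 0)" for t y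
  note tail_measurable_id [measurable]
  have "snd \<in> borel_measurable (lborel \<Otimes>\<^sub>M \<phi>)"
    using measurable_compose[OF measurable_snd tail_measurable_id, of lborel] by simp
  moreover have "fst \<in> borel_measurable (lborel \<Otimes>\<^sub>M \<phi>)"
    using measurable_fst[of lborel \<phi>] by simp
  ultimately have fm: "case_prod f \<in> borel_measurable (lborel \<Otimes>\<^sub>M \<phi>)"
    unfolding f_def case_prod_beta by measurable
  have f_eq: "f t = (\<lambda>y. indicator {t<..} y *\<^sub>R H t)" if "t > 0" for t
    using that by (auto simp: f_def indicator_def)
  have f_0: "f t = (\<lambda>y. 0)" if "\<not> t > 0" for t
    using that by (auto simp: f_def)
  have meas: "measure \<phi> {t<..} = \<Phi> t" if "t > 0" for t
    using tail[OF that] \<Phi>_nonneg[OF that] by (simp add: measure_def)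
  have int_f: "integrable \<phi> (f t)" for t
  proof (cases "t > 0")
    case True
    show ?thesis
      unfolding f_eq[OF True]
      by (intro integrable_scaleR_left integrable_real_indicator tail_sets) (simp_all add: True tail)
  qed (simp add: f_0)
  \<comment> \<open>For fixed \<open>t\<close> the norm integrates over \<open>y\<close> to
    \<open>\<Phi> t * |H t|\<close>, so absolute integrability on the product is the hypothesis on
    \<open>H\<close>.\<close>
  have "integrable (lborel \<Otimes>\<^sub>M \<phi>) (case_prod f)"
  proof (rule Fubini_integrable[OF fm])
    have "(\<integral>y. norm (f t y) \<partial>\<phi>) = norm (indicator {0<..} t *\<^sub>R (of_real (\<Phi> t) * H t))" for t
    proof (cases "t > 0")
      case True
      have "(\<integral>y. norm (f t y) \<partial>\<phi>) = (\<integral>y. indicator {t<..} y *\<^sub>R norm (H t) \<partial>\<phi>)"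
        by (simp add: f_eq[OF True])
      also have "\<dots> = \<Phi> t * norm (H t)"
        using True by (subst integral_scaleR_left)
          (auto intro!: integrable_real_indicator tail_sets simp: tail meas space_tail_measure Int_absorb2 subset_eq)
      finally show ?thesis
        using True \<Phi>_nonneg[OF True] by (simp add: norm_mult)
    qed (simp add: f_0)
    then show "integrable lborel (\<lambda>x. \<integral>y. norm (case (x, y) of (x, y) \<Rightarrow> f x y) \<partial>\<phi>)"
      using integrable_norm[OF Hi[unfolded set_integrable_def]] by simp
  qed (simp add: int_f)
  note int = this
  have in_y: "(\<integral>t. f t y \<partial>lborel) = (LBINT t:{0<..<y}. H t)" for y
    unfolding set_lebesgue_integral_def by (intro Bochner_Integration.integral_cong) (auto simp: f_def indicator_def)
  show "integrable \<phi> (\<lambda>y. LBINT t:{0<..<y}. H t)"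
    using integrable_snd[OF int] by (simp add: in_y)
  have "(\<integral>y. f t y \<partial>\<phi>) = indicator {0<..} t *\<^sub>R (of_real (\<Phi> t) * H t)" for t
  proof (cases "t > 0")
    case True
    then show ?thesis
      by (subst f_eq[OF True], subst integral_scaleR_left)
        (auto intro!: integrable_real_indicator tail_sets simp: tail meas space_tail_measure Int_absorb2 subset_eq scaleR_conv_of_real)
  qed (simp add: f_0)
  then show "(\<integral>y. (LBINT t:{0<..<y}. H t) \<partial>\<phi>) = (LBINT t:{0<..}. of_real (\<Phi> t) * H t)"
    using Fubini_integral[OF int] by (simp add: in_y set_lebesgue_integral_def)
qed

end

lemma LBINT_FTC_open:
  fixes F H :: "real \<Rightarrow> complex"
  assumes y: "y \<ge> 0" and H: "continuous_on {0..y} H"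
    and F: "\<And>t. t \<in> {0..y} \<Longrightarrow> (F has_vector_derivative H t) (at t within {0..y})"
  shows "(LBINT t:{0<..<y}. H t) = F y - F 0"
proof -
  have "set_integrable lborel {0<..<y} H"
    by (rule set_integrable_subset[OF borel_integrable_atLeastAtMost'[OF H]]) auto
  then have "(LBINT t:{0<..<y}. H t) = integral {0<..<y} H"
    by (rule set_borel_integral_eq_integral)
  also have "\<dots> = integral {0..y} H"
    by (simp add: integral_open_interval_real)
  also have "\<dots> = F y - F 0"
    by (rule integral_unique[OF fundamental_theorem_of_calculus[OF y F]]) 
  finally show ?thesis .
qed

text \<open>The layer cake formula for \<open>t * exp (- t)\<close>, whose primitive
  \<open>1 - (1 + y) * exp (- y)\<close> behaves like \<open>y^2 / 2\<close> near 0 and tends to 1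
  at infinity, and so dominates \<open>min 1 (y^2)\<close> up to a factor.\<close>

lemma min_square_integrable:
  fixes \<phi> :: "real measure" and \<Phi> :: "real \<Rightarrow> real"
  assumes sets_\<phi>: "sets \<phi> = sets (restrict_space borel {0<..})"
    and tail: "\<And>r. r > 0 \<Longrightarrow> emeasure \<phi> {r<..} = ennreal (\<Phi> r)"
    and \<Phi>: "\<And>r. r > 0 \<Longrightarrow> 0 \<le> \<Phi> r" "\<And>r. r > 0 \<Longrightarrow> r * \<Phi> r \<le> B"
    and \<Phi>_meas: "(\<lambda>t. indicator {0<..} t *\<^sub>R \<Phi> t) \<in> borel_measurable borel"
  shows "integrable \<phi> (\<lambda>y. min 1 (y\<^sup>2))"
proof -
  define H where "H t = complex_of_real (t * exp (- t))" for t
  define F where "F t = complex_of_real (1 - (1 + t) * exp (- t))" for t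
  have Hm: "H \<in> borel_measurable borel" unfolding H_def by measurable
  have "integrable lborel (\<lambda>t. indicator {0<..} t *\<^sub>R (of_real (\<Phi> t) * H t))"
  proof (rule Bochner_Integration.integrable_bound)
    show "integrable lborel (\<lambda>t. B * (indicator {0<..} t * ((1 + t) * exp (- (1 * t)))))"
      using exp_poly_integrable[of 1] by auto
    have "(\<lambda>t. complex_of_real (indicator {0<..} t *\<^sub>R \<Phi> t) * H t) \<in> borel_measurable lborel"
      using \<Phi>_meas Hm by measurable
    then show "(\<lambda>t. indicator {0<..} t *\<^sub>R (of_real (\<Phi> t) * H t)) \<in> borel_measurable lborel"
      by (simp add: scaleR_conv_of_real mult.assoc)
    show "AE t in lborel. norm (indicator {0<..} t *\<^sub>R (of_real (\<Phi> t) * H t))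
        \<le> norm (B * (indicator {0<..} t * ((1 + t) * exp (- (1 * t)))))"
    proof (rule AE_I2)
      fix t :: real
      show "norm (indicator {0<..} t *\<^sub>R (of_real (\<Phi> t) * H t))
        \<le> norm (B * (indicator {0<..} t * ((1 + t) * exp (- (1 * t)))))"
      proof (cases "t > 0")
        case True
        have b: "0 \<le> t * \<Phi> t" "t * \<Phi> t \<le> B"
          using True \<Phi>[of t] by auto
        have "norm (of_real (\<Phi> t) * H t) = (t * \<Phi> t) * exp (- t)"
          using True \<Phi>[of t] by (simp add: H_def norm_mult)
        also have "\<dots> \<le> B * ((1 + t) * exp (- t))"
          using b True by (intro mult_mono) auto
        finally show ?thesis using True b by (simp add: abs_mult)
      qed simp
    qed
  qed
  then have Hi: "set_integrable lborel {0<..} (\<lambda>t. of_real (\<Phi> t) * H t)"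
    by (simp add: set_integrable_def)
  have LF: "(LBINT t:{0<..<y}. H t) = F y" if "y > 0" for y
  proof -
    have "(LBINT t:{0<..<y}. H t) = F y - F 0"
    proof (rule LBINT_FTC_open)
      show "continuous_on {0..y} H" unfolding H_def by (intro continuous_intros)
      fix t
      have "((\<lambda>t. 1 - (1 + t) * exp (- t)) has_real_derivative (t * exp (- t))) (at t within {0..y})"
        by (auto intro!: derivative_eq_intros simp: algebra_simps)
      then show "(F has_vector_derivative H t) (at t within {0..y})"
        unfolding F_def H_def by (rule has_vector_derivative_of_real)
    qed (use that in simp)
    then show ?thesis by (simp add: F_def)
  qed
  have "integrable \<phi> (\<lambda>y. LBINT t:{0<..<y}. H t)"
    by (rule layer_cake(1)[OF sets_\<phi> tail \<Phi>(1) Hm Hi])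
  \<comment> \<open>With \<open>q = 1 + y + y^2 / 2 \<le> exp y\<close> the primitive is at least
    \<open>y^2 / (2 q)\<close>, and \<open>2 q\<close> is at most 5 for \<open>y \<le> 1\<close> and
    at most \<open>5 y^2\<close> for \<open>y > 1\<close>; hence the factor 5.\<close>
  then have Fi: "integrable \<phi> (\<lambda>y. 5 * (LBINT t:{0<..<y}. H t))"
    by auto
  show ?thesis
  proof (rule Bochner_Integration.integrable_bound[OF Fi])
    show "(\<lambda>y. min 1 (y\<^sup>2)) \<in> borel_measurable \<phi>"
      using tail_measurable_id[OF sets_\<phi> tail \<Phi>(1)] by measurable
    show "AE y in \<phi>. norm (min 1 (y\<^sup>2)) \<le> norm (5 * (LBINT t:{0<..<y}. H t))"
    proof (rule AE_I2)
      fix y assume "y \<in> space \<phi>"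
      then have y: "y > 0"
        using space_tail_measure[OF sets_\<phi> tail \<Phi>(1)] by simp
      define q where "q = 1 + y + y\<^sup>2 / 2"
      have q: "q > 0" "q \<le> exp y" using y exp_lower_Taylor_quadratic[of y] by (auto simp: q_def add_pos_pos)
      have "(1 + y) * exp (- y) \<le> (1 + y) / q"
        unfolding exp_minus divide_inverse[symmetric] using q y by (intro divide_left_mono) auto
      then have "1 - (1 + y) * exp (- y) \<ge> 1 - (1 + y) / q" by simp
      also have "1 - (1 + y) / q = (y\<^sup>2 / 2) / q"
        using q by (simp add: field_simps) (simp add: q_def algebra_simps)
      finally have F1: "5 * (1 - (1 + y) * exp (- y)) \<ge> 5 * ((y\<^sup>2 / 2) / q)" by simp
      have "min 1 (y\<^sup>2) \<le> 5 * ((y\<^sup>2 / 2) / q)"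
      proof (cases "y \<le> 1")
        case True
        then have "y\<^sup>2 \<le> 1" using y by (simp add: power_le_one)
        then have "2 * q \<le> 5" using True by (simp add: q_def)
        then have "y\<^sup>2 * (2 * q) \<le> y\<^sup>2 * 5" by (intro mult_left_mono) auto
        then have "y\<^sup>2 \<le> 5 * ((y\<^sup>2 / 2) / q)" using q by (simp add: field_simps)
        then show ?thesis by simp
      next
        case False
        then have "y * 1 \<le> y * y" using y by (intro mult_left_mono) auto
        moreover have "1 \<le> y * y" using calculation False by linarith
        ultimately have "2 * q \<le> 5 * y\<^sup>2" by (simp add: q_def power2_eq_square)
        then have "1 \<le> 5 * ((y\<^sup>2 / 2) / q)" using q by (simp add: field_simps)
        then show ?thesis by simp
      qed
      also note F1
      also have "5 * (1 - (1 + y) * exp (- y)) \<le> norm (5 * (LBINT t:{0<..<y}. H t))"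
        unfolding LF[OF y] F_def norm_mult norm_of_real norm_numeral by (intro mult_left_mono abs_ge_self) simp
      finally show "norm (min 1 (y\<^sup>2)) \<le> norm (5 * (LBINT t:{0<..<y}. H t))" by simp
    qed
  qed
qed

section \<open>The damped integrand\<close>

text \<open>Both exponents are parameters so that one expression covers the damped function, at
  \<open>z = e - i x\<close> and \<open>w = e + i\<close>, and the original integrand, at
  \<open>z = - i x\<close> and \<open>w = i\<close>. For \<open>w = e + i\<close> the quotient by
  \<open>2 i\<close> is \<open>exp (- e y) * sin y\<close>.\<close>

definition damped :: "complex \<Rightarrow> complex \<Rightarrow> real \<Rightarrow> complex" where
  "damped z w y = exp (- (z * of_real y)) - 1
     + z * ((exp (- (cnj w * of_real y)) - exp (- (w * of_real y))) / (2 * \<i>))"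

definition damped_deriv :: "complex \<Rightarrow> complex \<Rightarrow> real \<Rightarrow> complex" where
  "damped_deriv z w t = z * (- exp (- (z * of_real t))
     + (w * exp (- (w * of_real t)) - cnj w * exp (- (cnj w * of_real t))) / (2 * \<i>))"

lemma damped_0: "damped z w 0 = 0"
  by (simp add: damped_def)

lemma has_vector_derivative_damped:
  "(damped z w has_vector_derivative damped_deriv z w t) (at t within S)"
proof -
  have "((\<lambda>y. exp (- (z * y)) - 1 + z * ((exp (- (cnj w * y)) - exp (- (w * y))) / (2 * \<i>)))
     has_field_derivative damped_deriv z w t) (at (of_real t))"
    unfolding damped_deriv_def by (auto intro!: derivative_eq_intros simp: field_simps)
  from has_vector_derivative_real_field[OF this] show ?thesis
    by (simp add: damped_def[abs_def] has_vector_derivative_at_within)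
qed

lemma continuous_on_damped_deriv: "continuous_on S (damped_deriv z w)"
  unfolding damped_deriv_def by (intro continuous_intros) auto

lemma damped_imaginary: "damped (- \<i> * of_real x) \<i> y = zolotarev_integrand x y"
proof -
  have "(exp (\<i> * of_real y) - exp (- (\<i> * of_real y))) / (2 * \<i>) = of_real (sin y)"
    by (simp add: sin_exp_eq sin_of_real[symmetric])
  then show ?thesis
    by (simp add: damped_def zolotarev_integrand_def algebra_simps)
qed

lemma norm_exp_quadratic_le:
  assumes "0 \<le> Re z" "Re z \<le> 1" "0 \<le> y" "y \<le> 1"
  shows "norm (exp (- (z * of_real y)) - 1 + z * of_real y) \<le> exp 1 * ((norm z)\<^sup>2 * y\<^sup>2)"
proof -
  have "norm (exp (- (z * of_real y)) - (\<Sum>k\<le>1. (- (z * of_real y)) ^ k / fact k))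
     \<le> exp \<bar>Re (- (z * of_real y))\<bar> * (norm (- (z * of_real y))) ^ Suc 1 / fact 1"
    by (rule Taylor_exp)
  also have "\<dots> = exp (Re z * y) * ((norm z)\<^sup>2 * y\<^sup>2)"
    using assms by (simp add: norm_mult power2_eq_square abs_mult)
  also have "\<dots> \<le> exp 1 * ((norm z)\<^sup>2 * y\<^sup>2)"
    using assms mult_mono[of "Re z" 1 y 1] by (intro mult_right_mono) auto
  finally show ?thesis by (simp add: algebra_simps)
qed

text \<open>The majorant for removing the damping, uniform in \<open>z\<close> and \<open>w\<close>.
  Near 0 the terms linear in \<open>y\<close> cancel because \<open>Im w = 1\<close>, leaving Taylor
  remainders of second order; beyond 1 no exponential exceeds modulus 1.\<close>

lemma norm_damped_le:
  assumes z: "0 \<le> Re z" "Re z \<le> 1" "norm z \<le> R" and w: "0 \<le> Re w" "Re w \<le> 1" "Im w = 1" and y: "y \<ge> 0"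
  shows "norm (damped z w y) \<le> (exp 1 * R\<^sup>2 + 2 * exp 1 * R + 2) * min 1 (y\<^sup>2)"
proof -
  have R: "R \<ge> 0" using z(3) norm_ge_zero[of z] by linarith
  have w2: "(norm w)\<^sup>2 \<le> 2"
    using w power_le_one[of "Re w" 2] by (simp add: cmod_power2)
  show ?thesis
  proof (cases "y \<le> 1")
    case True
    \<comment> \<open>The three exponentials minus their Taylor polynomials of degree 1; the
      discarded linear parts add up to zero.\<close>
    define a b b' where "a = exp (- (z * of_real y)) - 1 + z * of_real y"
      and "b = exp (- (w * of_real y)) - 1 + w * of_real y"
      and "b' = exp (- (cnj w * of_real y)) - 1 + cnj w * of_real y"
    have a: "norm a \<le> exp 1 * (R\<^sup>2 * y\<^sup>2)"
      using order.trans[OF norm_exp_quadratic_le[OF z(1,2) y True] mult_left_mono[OF mult_right_mono[OF power_mono[OF z(3)]]]]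
      by (simp add: a_def)
    have b: "norm b \<le> exp 1 * (2 * y\<^sup>2)"
      using order.trans[OF norm_exp_quadratic_le[OF w(1,2) y True] mult_left_mono[OF mult_right_mono[OF w2]]]
      by (simp add: b_def)
    have "b' = cnj b" by (simp add: b_def b'_def exp_cnj)
    then have b': "norm b' \<le> exp 1 * (2 * y\<^sup>2)" using b by simp
    have "w - cnj w = 2 * \<i>" using w(3) by (simp add: complex_eq_iff)
    moreover have "a + z * ((b' - b) / (2 * \<i>)) = damped z w y + z * of_real y * (1 - (w - cnj w) / (2 * \<i>))"
      by (simp add: damped_def a_def b_def b'_def add_divide_distrib diff_divide_distrib algebra_simps)
    ultimately have d: "damped z w y = a + z * ((b' - b) / (2 * \<i>))"
      by simp
    have "norm (z * ((b' - b) / (2 * \<i>))) = norm z * (norm (b' - b) / 2)"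
      by (simp add: norm_mult norm_divide)
    also have "\<dots> \<le> norm z * ((norm b' + norm b) / 2)"
      by (intro mult_left_mono divide_right_mono norm_triangle_ineq4) auto
    finally have "norm (damped z w y) \<le> norm a + norm z * ((norm b' + norm b) / 2)"
      unfolding d using norm_triangle_ineq[of a "z * ((b' - b) / (2 * \<i>))"] by linarith
    also have "\<dots> \<le> exp 1 * (R\<^sup>2 * y\<^sup>2) + R * ((exp 1 * (2 * y\<^sup>2) + exp 1 * (2 * y\<^sup>2)) / 2)"
      using a b b' z R by (intro add_mono mult_mono divide_right_mono) auto
    also have "\<dots> = (exp 1 * R\<^sup>2 + 2 * exp 1 * R) * y\<^sup>2" by (simp add: algebra_simps)
    also have "\<dots> \<le> (exp 1 * R\<^sup>2 + 2 * exp 1 * R + 2) * y\<^sup>2" by (intro mult_right_mono) auto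
    also have "y\<^sup>2 = min 1 (y\<^sup>2)" using power_le_one[OF y True, of 2] by simp
    finally show ?thesis .
  next
    case False
    have e: "norm (exp (- (u * of_real y))) \<le> 1" if "0 \<le> Re u" for u
      using that y by simp
    have "norm (damped z w y) \<le> norm (exp (- (z * of_real y))) + 1
       + norm z * ((norm (exp (- (cnj w * of_real y))) + norm (exp (- (w * of_real y)))) / 2)"
      unfolding damped_def
      by (auto simp: norm_mult norm_divide intro!: order.trans[OF norm_triangle_ineq] add_mono mult_left_mono
          order.trans[OF norm_triangle_ineq4] simp del: norm_exp_eq_Re)
    also have "\<dots> \<le> 1 + 1 + R * ((1 + 1) / 2)"
      using e[of z] e[of w] e[of "cnj w"] z w R by (intro add_mono mult_mono divide_right_mono) (auto simp del: norm_exp_eq_Re)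
    also have "\<dots> \<le> exp 1 * R\<^sup>2 + 2 * exp 1 * R + 2"
    proof -
      have "1 * R \<le> exp 1 * R" using R by (intro mult_right_mono) auto
      moreover have "0 \<le> exp 1 * R\<^sup>2" by simp
      moreover have "2 * exp 1 * R = 2 * (exp 1 * R)" "R * ((1 + 1) / 2) = R" by simp_all
      ultimately show ?thesis using R by linarith
    qed
    also have "\<dots> = (exp 1 * R\<^sup>2 + 2 * exp 1 * R + 2) * min 1 (y\<^sup>2)"
      using False by (simp add: min_def one_le_power)
    finally show ?thesis .
  qed
qed

(* Only combinations whose coefficients add up to zero are used: there the pole of Gamma at v = 0
   cancels and leaves the logarithm. *)
definition mellin :: "real \<Rightarrow> complex \<Rightarrow> complex" where
  "mellin v z = (if v = 0 then - Ln z else Gamma (\<i> * of_real v) * z powr (- (\<i> * of_real v)))"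

text \<open>Arises from \<open>damped_deriv z w t\<close> by replacing each
  \<open>exp (- (u * t))\<close> with \<open>mellin v u\<close>.\<close>

definition damped_mellin :: "real \<Rightarrow> complex \<Rightarrow> complex \<Rightarrow> complex" where
  "damped_mellin v z w = z * (- mellin v z + (w * mellin v w - cnj w * mellin v (cnj w)) / (2 * \<i>))"

text \<open>As the coefficients \<open>- 1\<close>, \<open>w / (2 i)\<close> and
  \<open>- cnj w / (2 i)\<close> add up to zero, \<open>exp (- t)\<close> can be subtracted from
  each exponential without changing the combination, and each difference has a convergent Mellin
  integral.\<close>

lemma damped_mellin_integral:
  assumes z: "Re z > 0" and w: "Re w > 0" "Im w = 1"
  shows "set_integrable lborel {0<..} (\<lambda>t. complex_of_real t powr (\<i> * of_real v - 1) * damped_deriv z w t)"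
    and "(LBINT t:{0<..}. complex_of_real t powr (\<i> * of_real v - 1) * damped_deriv z w t) = damped_mellin v z w"
proof -
  define E where "E u t = complex_of_real t powr (\<i> * of_real v - 1) * (exp (- (u * of_real t)) - exp (- of_real t))" for u t
  define M where "M u = (if v = 0 then - Ln u else Gamma (\<i> * of_real v) * (u powr (- (\<i> * of_real v)) - 1))" for u
  have E: "set_integrable lborel {0<..} (E u)" "(LBINT t:{0<..}. E u t) = M u" if "Re u > 0" for u
    using powr_exp_diff_integral[OF that, of v] by (simp_all add: E_def[abs_def] M_def)
  have cw: "Re (cnj w) > 0" using w by simp
  have ww: "w - cnj w = 2 * \<i>" using w(2) by (simp add: complex_eq_iff)
  have eq: "complex_of_real t powr (\<i> * of_real v - 1) * damped_deriv z w t
      = (- z) * E z t + (z * w / (2 * \<i>)) * E w t - (z * cnj w / (2 * \<i>)) * E (cnj w) t" for t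
  proof -
    have "(- z) * E z t + (z * w / (2 * \<i>)) * E w t - (z * cnj w / (2 * \<i>)) * E (cnj w) t
      = complex_of_real t powr (\<i> * of_real v - 1) * (damped_deriv z w t + z * exp (- of_real t) * (1 - (w - cnj w) / (2 * \<i>)))"
      by (simp add: E_def damped_deriv_def add_divide_distrib diff_divide_distrib algebra_simps)
    then show ?thesis by (simp add: ww)
  qed
  show "set_integrable lborel {0<..} (\<lambda>t. complex_of_real t powr (\<i> * of_real v - 1) * damped_deriv z w t)"
    unfolding eq
    by (intro set_integral_add set_integral_diff set_integrable_mult_right E z w cw impI)
  have "(LBINT t:{0<..}. complex_of_real t powr (\<i> * of_real v - 1) * damped_deriv z w t) =
     (- z) * M z + (z * w / (2 * \<i>)) * M w - (z * cnj w / (2 * \<i>)) * M (cnj w)"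
  proof -
    have i: "set_integrable lborel {0<..} (\<lambda>t. b * E u t)" if "Re u > 0" for b u
      using E(1)[OF that] by (intro set_integrable_mult_right)
    show ?thesis
      unfolding eq set_integral_diff(2)[OF set_integral_add(1)[OF i[OF z] i[OF w(1)]] i[OF cw]]
        set_integral_add(2)[OF i[OF z] i[OF w(1)]] set_integral_mult_right
        E(2)[OF z] E(2)[OF w(1)] E(2)[OF cw] ..
  qed
  also have "\<dots> = damped_mellin v z w"
  proof (cases "v = 0")
    case True
    then show ?thesis by (simp add: M_def damped_mellin_def mellin_def add_divide_distrib diff_divide_distrib algebra_simps)
  next
    case False
    \<comment> \<open>The same vanishing sum of coefficients removes the \<open>- 1\<close> inside
      \<open>M\<close>.\<close>
    have "(- z) * M z + (z * w / (2 * \<i>)) * M w - (z * cnj w / (2 * \<i>)) * M (cnj w)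
      = damped_mellin v z w + Gamma (\<i> * of_real v) * z * (1 - (w - cnj w) / (2 * \<i>))"
      using False by (simp add: M_def damped_mellin_def mellin_def add_divide_distrib diff_divide_distrib algebra_simps)
    then show ?thesis by (simp add: ww)
  qed
  finally show "(LBINT t:{0<..}. complex_of_real t powr (\<i> * of_real v - 1) * damped_deriv z w t) = damped_mellin v z w" .
qed

text \<open>The modulus is \<open>exp (v * Im (Ln z))\<close>, and arguments in the right half-plane
  are at most \<open>pi / 2\<close> in absolute value.\<close>

lemma norm_powr_imaginary_le:
  assumes "Re z > 0"
  shows "norm (z powr (- (\<i> * of_real v))) \<le> exp (pi / 2 * \<bar>v\<bar>)"
proof -
  have z: "z \<noteq> 0" using assms by auto
  have "\<bar>Im (Ln z)\<bar> \<le> pi / 2" using Re_Ln_pos_le[OF z] assms by simp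
  then have "v * Im (Ln z) \<le> \<bar>v\<bar> * (pi / 2)"
    by (metis abs_ge_self abs_mult mult_left_mono abs_ge_zero order.trans)
  then show ?thesis using z by (simp add: powr_def mult.commute)
qed

text \<open>Growth of the powers and decay of Gamma cancel, so \<open>v\<close> enters only through
  the lower bound \<open>a\<close>. The estimate is thus uniform both in the frequency and in the
  damping.\<close>

lemma norm_damped_mellin_le:
  assumes z: "Re z > 0" and w: "Re w > 0" and a: "a > 0" "\<bar>v\<bar> \<ge> a"
  shows "norm (damped_mellin v z w) \<le> sqrt (2 * pi / (a * (1 - exp (- (2 * pi * a))))) * (norm z * (1 + norm w))"
proof -
  define K where "K = sqrt (2 * pi / (a * (1 - exp (- (2 * pi * a)))))"
  have v: "v \<noteq> 0" using a by auto
  have "(norm (Gamma (\<i> * of_real v)) * exp (pi / 2 * \<bar>v\<bar>))\<^sup>2 = (norm (Gamma (\<i> * of_real v)))\<^sup>2 * exp (pi * \<bar>v\<bar>)"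
    by (simp add: power_mult_distrib exp_double[symmetric])
  also have "\<dots> \<le> 2 * pi / (a * (1 - exp (- (2 * pi * a))))"
    by (rule norm_Gamma_imaginary_le[OF a])
  finally have K: "norm (Gamma (\<i> * of_real v)) * exp (pi / 2 * \<bar>v\<bar>) \<le> K"
    unfolding K_def by (rule real_le_rsqrt)
  have M: "norm (mellin v u) \<le> K" if "Re u > 0" for u
    using order.trans[OF mult_left_mono[OF norm_powr_imaginary_le[OF that, of v]] K] v by (simp add: mellin_def norm_mult)
  have "norm (damped_mellin v z w) \<le> norm z * (norm (mellin v z) + (norm w * norm (mellin v w) + norm w * norm (mellin v (cnj w))) / 2)"
    unfolding damped_mellin_def
    by (auto simp: norm_mult norm_divide intro!: mult_left_mono order.trans[OF norm_triangle_ineq] add_mono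
        order.trans[OF norm_triangle_ineq4])
  also have "\<dots> \<le> norm z * (K + (norm w * K + norm w * K) / 2)"
    using z w by (intro mult_left_mono add_mono divide_right_mono M) auto
  also have "\<dots> = K * (norm z * (1 + norm w))" by (simp add: algebra_simps)
  finally show ?thesis by (simp add: K_def)
qed

text \<open>The imaginary axis without 0 avoids the branch cut, so the limit may be taken onto the
  boundary of the half-plane.\<close>

lemma tendsto_damped_mellin:
  assumes f: "(f \<longlongrightarrow> z) F" and g: "(g \<longlongrightarrow> w) F" and z: "z \<notin> \<real>\<^sub>\<le>\<^sub>0" and w: "w \<notin> \<real>\<^sub>\<le>\<^sub>0"
  shows "((\<lambda>x. damped_mellin v (f x) (g x)) \<longlongrightarrow> damped_mellin v z w) F"
proof -
  have M: "((\<lambda>x. mellin v (h x)) \<longlongrightarrow> mellin v u) F" if "(h \<longlongrightarrow> u) F" "u \<notin> \<real>\<^sub>\<le>\<^sub>0" for h u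
    unfolding mellin_def
    by (cases "v = 0") (auto intro!: tendsto_minus tendsto_Ln tendsto_mult tendsto_powr_complex that)
  have cw: "cnj w \<notin> \<real>\<^sub>\<le>\<^sub>0" using w by (auto simp: complex_nonpos_Reals_iff)
  show ?thesis
    unfolding damped_mellin_def
    by (intro tendsto_mult tendsto_add tendsto_minus tendsto_divide tendsto_diff tendsto_cnj tendsto_const M f g z w cw) simp
qed

text \<open>The contribution of the sine vanishes because
  \<open>Ln i + Ln (- i) = 0\<close>.\<close>

lemma damped_mellin_boundary_0:
  "damped_mellin 0 (- \<i> * of_real x) \<i> = - \<i> * of_real x * Ln (- \<i> * of_real x)"
  by (simp add: damped_mellin_def mellin_def)

text \<open>The sine contributes the mean of \<open>i powr (- i v)\<close> and
  \<open>(- i) powr (- i v)\<close>, that is, of \<open>exp (pi v / 2)\<close> and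
  \<open>exp (- pi v / 2)\<close>; this is the cosine at the imaginary point
  \<open>i pi v / 2\<close>.\<close>

lemma damped_mellin_boundary:
  assumes "v \<noteq> 0" "x \<noteq> 0"
  shows "damped_mellin v (- \<i> * of_real x) \<i> = - (Gamma (\<i> * of_real v) *
      ((- \<i> * of_real x) powr (1 - \<i> * of_real v) + \<i> * of_real x * cos (of_real (pi / 2) * (\<i> * of_real v))))"
proof -
  define z where "z = - \<i> * of_real x"
  have p: "\<i> powr (- (\<i> * of_real v)) = exp (of_real (pi / 2 * v))"
    by (simp add: powr_def algebra_simps)
  have q: "(- \<i>) powr (- (\<i> * of_real v)) = exp (- of_real (pi / 2 * v))"
    by (simp add: powr_def algebra_simps)
  have c: "cos (of_real (pi / 2) * (\<i> * of_real v)) = (exp (of_real (pi / 2 * v)) + exp (- of_real (pi / 2 * v))) / 2"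
    by (simp add: cos_exp_eq algebra_simps)
  have zp: "z powr (1 - \<i> * of_real v) = z * z powr (- (\<i> * of_real v))"
    using powr_add[of z 1 "- (\<i> * of_real v)"] assms by (simp add: z_def)
  have "damped_mellin v z \<i> = z * Gamma (\<i> * of_real v) * (- (z powr (- (\<i> * of_real v)))
     + (exp (of_real (pi / 2 * v)) + exp (- of_real (pi / 2 * v))) / 2)"
    using assms(1) by (simp add: damped_mellin_def mellin_def p[simplified] q[simplified] add_divide_distrib diff_divide_distrib algebra_simps)
  also note c[symmetric]
  also have "z * Gamma (\<i> * of_real v) * (- (z powr (- (\<i> * of_real v))) + cos (of_real (pi / 2) * (\<i> * of_real v)))
    = - (Gamma (\<i> * of_real v) * (z powr (1 - \<i> * of_real v) + \<i> * of_real x * cos (of_real (pi / 2) * (\<i> * of_real v))))"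
    unfolding zp by (simp add: z_def algebra_simps)
  finally show ?thesis by (simp add: z_def)
qed

section \<open>Insertion of the Fourier series under the tail integral\<close>

lemma trig_ln_powr:
  assumes "t > 0"
  shows "trig T k (ln t) / of_real t = complex_of_real t powr (\<i> * of_real (of_int k * (2 * pi / T)) - 1)"
proof -
  have "complex_of_real t powr (\<i> * of_real (of_int k * (2 * pi / T)) - 1)
     = complex_of_real t powr (\<i> * of_real (of_int k * (2 * pi / T))) / of_real t"
    using assms by (simp add: powr_diff)
  also have "complex_of_real t powr (\<i> * of_real (of_int k * (2 * pi / T))) = trig T k (ln t)"
    using assms by (simp add: powr_def trig_def Ln_of_real mult_ac)
  finally show ?thesis ..
qed

text \<open>The layer cake formula turns the integral into one of \<open>h'(t)\<close> against
  \<open>\<theta> (ln t) / t\<close>. On the logarithmic scale harmonics are imaginary powers, so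
  integrating the series termwise gives Mellin transforms.\<close>

lemma damped_integral_fourier:
  fixes \<theta> :: "real \<Rightarrow> real" and ck :: "int \<Rightarrow> complex"
  assumes sets_\<phi>: "sets \<phi> = sets (restrict_space borel {0<..})"
    and tail: "\<And>r. r > 0 \<Longrightarrow> emeasure \<phi> {r<..} = ennreal (\<theta> (ln r) / r)"
    and pos: "\<And>u. 0 \<le> \<theta> u" and cont: "continuous_on UNIV \<theta>"
    and summ: "(\<lambda>k. norm (ck k)) summable_on UNIV"
    and series: "\<And>u. ((\<lambda>k. ck k * trig T k u) has_sum of_real (\<theta> u)) UNIV"
    and z: "Re z > 0" and w: "Re w > 0" "Im w = 1"
  shows "(\<lambda>N. \<Sum>k = - int N..int N. ck k * damped_mellin (of_int k * (2 * pi / T)) z w) \<longlonglongrightarrow> (\<integral>y. damped z w y \<partial>\<phi>)"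
proof -
  define \<Phi> where "\<Phi> r = \<theta> (ln r) / r" for r
  define B where "B = (\<Sum>\<^sub>\<infinity>k. norm (ck k))"
  define H where "H = damped_deriv z w"
  define p where "p k = \<i> * complex_of_real (of_int k * (2 * pi / T)) - 1" for k :: int
  define F where "F N t = indicator {0<..} t *\<^sub>R ((\<Sum>k = - int N..int N. ck k * complex_of_real t powr p k) * H t)" for N t
  define f where "f t = indicator {0<..} t *\<^sub>R (of_real (\<Phi> t) * H t)" for t
  \<comment> \<open>The partial sums are bounded by \<open>B\<close> uniformly in \<open>N\<close>
    and \<open>t\<close>; that \<open>|h'(t)| / t\<close> is integrable is the Mellin statement for
    the exponent 0.\<close>
  define g where "g t = B * norm (indicator {0<..} t *\<^sub>R (complex_of_real t powr (\<i> * of_real 0 - 1) * H t))" for t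
  have Hm [measurable]: "H \<in> borel_measurable borel"
    unfolding H_def by (rule borel_measurable_continuous_onI[OF continuous_on_damped_deriv])
  have partial: "norm (\<Sum>k = - int N..int N. ck k * trig T k u) \<le> B" for N u
  proof -
    have "norm (\<Sum>k = - int N..int N. ck k * trig T k u) \<le> (\<Sum>k = - int N..int N. norm (ck k))"
      by (rule order.trans[OF norm_sum]) (simp add: norm_mult)
    also have "\<dots> \<le> B"
      unfolding B_def using summ by (intro finite_sum_le_infsum) auto
    finally show ?thesis .
  qed
  have "integrable lborel (\<lambda>t. norm (indicator {0<..} t *\<^sub>R (complex_of_real t powr (\<i> * of_real 0 - 1) * H t)))"
    using damped_mellin_integral(1)[OF z w, of 0] unfolding H_def set_integrable_def by (rule integrable_norm)
  then have g: "integrable lborel g"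
    unfolding g_def[abs_def] by auto
  have Phi_meas: "(\<lambda>t. indicator {0<..} t *\<^sub>R \<Phi> t) \<in> borel_measurable borel"
    unfolding \<Phi>_def
    by (rule borel_measurable_continuous_on_indicator)
      (auto intro!: continuous_intros continuous_on_compose2[OF cont])
  have fm: "f \<in> borel_measurable lborel"
  proof -
    have "(\<lambda>t. complex_of_real (indicator {0<..} t *\<^sub>R \<Phi> t) * H t) \<in> borel_measurable lborel"
      using Phi_meas by measurable
    then show ?thesis by (simp add: f_def[abs_def] scaleR_conv_of_real mult.assoc)
  qed
  have Fi0: "integrable lborel (\<lambda>t. indicator {0<..} t *\<^sub>R (complex_of_real t powr p k * H t))" for k
    using damped_mellin_integral(1)[OF z w, of "of_int k * (2 * pi / T)"] by (simp add: p_def H_def set_integrable_def)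
  have F_eq: "F N = (\<lambda>t. \<Sum>k = - int N..int N. ck k * (indicator {0<..} t *\<^sub>R (complex_of_real t powr p k * H t)))" for N
  proof
    fix t
    show "F N t = (\<Sum>k = - int N..int N. ck k * (indicator {0<..} t *\<^sub>R (complex_of_real t powr p k * H t)))"
      by (cases "t > 0") (simp_all add: F_def sum_distrib_right mult.assoc)
  qed
  have Fint: "integrable lborel (F N)" for N
    unfolding F_eq using Fi0 by (intro Bochner_Integration.integrable_sum integrable_mult_right) auto
  have Fm: "F N \<in> borel_measurable lborel" for N
    using Fint by (rule borel_measurable_integrable)
  have pw: "complex_of_real t powr p k = trig T k (ln t) / of_real t" if "t > 0" for t k
    unfolding p_def trig_ln_powr[OF that] ..
  have sum_pw: "(\<Sum>k = - int N..int N. ck k * complex_of_real t powr p k) = (\<Sum>k = - int N..int N. ck k * trig T k (ln t)) / of_real t"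
    if "t > 0" for t N
    by (simp add: pw[OF that] sum_divide_distrib)
  have lim: "AE t in lborel. (\<lambda>N. F N t) \<longlonglongrightarrow> f t"
  proof (rule AE_I2)
    fix t
    show "(\<lambda>N. F N t) \<longlonglongrightarrow> f t"
    proof (cases "t > 0")
      case True
      have "(\<lambda>N. (\<Sum>k = - int N..int N. ck k * trig T k (ln t)) / of_real t) \<longlonglongrightarrow> of_real (\<theta> (ln t)) / of_real t"
        using True by (intro tendsto_divide has_sum_imp_symmetric_limit[OF series] tendsto_const) auto
      then have "(\<lambda>N. \<Sum>k = - int N..int N. ck k * complex_of_real t powr p k) \<longlonglongrightarrow> of_real (\<Phi> t)"
        unfolding sum_pw[OF True] by (simp add: \<Phi>_def)
      then show ?thesis
        unfolding F_def f_def by (intro tendsto_scaleR tendsto_mult tendsto_const)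
    qed (simp add: F_def f_def)
  qed
  have bound: "AE t in lborel. norm (F N t) \<le> g t" for N
  proof (rule AE_I2)
    fix t
    show "norm (F N t) \<le> g t"
    proof (cases "t > 0")
      case True
      have "norm (F N t) = norm (\<Sum>k = - int N..int N. ck k * trig T k (ln t)) / t * norm (H t)"
        using True by (simp add: F_def sum_pw norm_mult norm_divide)
      also have "\<dots> \<le> B / t * norm (H t)"
        using True partial by (intro mult_right_mono divide_right_mono) auto
      also have "\<dots> = g t"
        using True by (simp add: g_def norm_mult norm_divide norm_of_real_powr powr_minus_divide)
      finally show ?thesis .
    qed (simp add: F_def g_def)
  qed
  have conv: "(\<lambda>N. \<integral>t. F N t \<partial>lborel) \<longlonglongrightarrow> (\<integral>t. f t \<partial>lborel)"
    by (rule integral_dominated_convergence[OF fm Fm g lim bound])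
  have fi: "integrable lborel f"
    by (rule integrable_dominated_convergence[OF fm Fm g lim bound])
  have F_int: "(\<integral>t. F N t \<partial>lborel) = (\<Sum>k = - int N..int N. ck k * damped_mellin (of_int k * (2 * pi / T)) z w)" for N
  proof -
    have "(\<integral>t. indicator {0<..} t *\<^sub>R (complex_of_real t powr p k * H t) \<partial>lborel) = damped_mellin (of_int k * (2 * pi / T)) z w" for k
      using damped_mellin_integral(2)[OF z w, of "of_int k * (2 * pi / T)"] by (simp add: p_def H_def set_lebesgue_integral_def)
    then show ?thesis
      unfolding F_eq using Fi0 by (subst Bochner_Integration.integral_sum) (auto simp del: mult_scaleR_right)
  qed
  have tail': "r > 0 \<Longrightarrow> emeasure \<phi> {r<..} = ennreal (\<Phi> r)" for r
    by (simp add: \<Phi>_def tail)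
  have Phi0: "r > 0 \<Longrightarrow> 0 \<le> \<Phi> r" for r by (simp add: \<Phi>_def pos)
  have fi': "set_integrable lborel {0<..} (\<lambda>t. of_real (\<Phi> t) * H t)"
    using fi by (simp add: f_def[abs_def] set_integrable_def)
  have "(LBINT t:{0<..<y}. H t) = damped z w y" if "y > 0" for y
    using LBINT_FTC_open[of y H "damped z w"] that
    by (simp add: H_def continuous_on_damped_deriv has_vector_derivative_damped damped_0)
  then have "(\<integral>y. damped z w y \<partial>\<phi>) = (\<integral>y. (LBINT t:{0<..<y}. H t) \<partial>\<phi>)"
    using space_tail_measure[OF sets_\<phi> tail' Phi0] by (intro Bochner_Integration.integral_cong) auto
  also have "\<dots> = (\<integral>t. f t \<partial>lborel)"
    using layer_cake(2)[OF sets_\<phi> tail' Phi0 Hm fi'] by (simp add: f_def set_lebesgue_integral_def)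
  finally show ?thesis
    using conv by (simp add: F_int)
qed

text \<open>Integrability and summability are part of the conclusion because the integral and the
  infinite sum are total and would otherwise take a default value. At \<open>x = 0\<close> the
  factor \<open>x\<close> makes the logarithmic term 0, as the convention demands.\<close>

theorem theorem3p4:
  fixes c ct :: real and \<theta> :: "real \<Rightarrow> real" and ck :: "int \<Rightarrow> complex"
    and \<phi> :: "real measure" and \<psi> :: "real \<Rightarrow> complex"
  assumes c: "c > 1"
    and \<theta>: "smooth_admissable c 1 \<theta>"
    and ct: "ct = 2 * pi / ln c"
    and ck: "\<And>k. ck k = fourier_coeff (ln c) \<theta> k"
    and sets_\<phi>: "sets \<phi> = sets (restrict_space borel {0<..})"
    and tail_\<phi>: "\<And>r. r > 0 \<Longrightarrow> emeasure \<phi> {r<..} = ennreal (\<theta> (ln r) / r)"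
    and \<psi>: "\<And>x. \<psi> x = zolotarev_log_char \<phi> x"
  shows "\<forall>x::real.
    integrable \<phi> (zolotarev_integrand x) \<and>
    (\<lambda>k::int. ck k * Gamma (\<i> * of_int k * of_real ct) *
        ((- \<i> * of_real x) powr (1 - \<i> * of_int k * of_real ct)
         + \<i> * of_real x * cos (of_real (pi / 2) * \<i> * of_int k * of_real ct)))
      summable_on (UNIV - {0}) \<and>
    \<psi> x =
      - (\<Sum>\<^sub>\<infinity>k::int\<in>UNIV - {0}. ck k * Gamma (\<i> * of_int k * of_real ct) *
          ((- \<i> * of_real x) powr (1 - \<i> * of_int k * of_real ct)
           + \<i> * of_real x * cos (of_real (pi / 2) * \<i> * of_int k * of_real ct)))
      - ck 0 * \<i> * of_real x * Ln (- \<i> * of_real x)"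
proof
  fix x :: real
  have ct0: "ct > 0" using c ct by simp
  have pos: "0 \<le> \<theta> u" for u
    using \<theta> by (simp add: smooth_admissable_def admissable_def less_imp_le)
  have cont: "continuous_on UNIV \<theta>"
    using \<theta> by (simp add: smooth_admissable_def)
  have summ: "(\<lambda>k. norm (ck k)) summable_on UNIV"
    using smooth_admissable_fourier(1)[OF c \<theta>] by (simp add: ck)
  have series: "((\<lambda>k. ck k * trig (ln c) k u) has_sum of_real (\<theta> u)) UNIV" for u
    using smooth_admissable_fourier(2)[OF c \<theta>] by (simp add: ck)
  define \<Phi> where "\<Phi> r = \<theta> (ln r) / r" for r
  have tail': "r > 0 \<Longrightarrow> emeasure \<phi> {r<..} = ennreal (\<Phi> r)" for r
    by (simp add: \<Phi>_def tail_\<phi>)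
  have Phi0: "r > 0 \<Longrightarrow> 0 \<le> \<Phi> r" for r by (simp add: \<Phi>_def pos)
  have space: "space \<phi> = {0<..}"
    by (rule space_tail_measure[OF sets_\<phi> tail' Phi0])
  have id_meas: "(\<lambda>y. y) \<in> borel_measurable \<phi>"
    by (rule tail_measurable_id[OF sets_\<phi> tail' Phi0])
  have env: "integrable \<phi> (\<lambda>y. min 1 (y\<^sup>2))"
  proof (rule min_square_integrable[OF sets_\<phi> tail' Phi0])
    fix r :: real assume "r > 0"
    \<comment> \<open>The Fourier series bounds \<open>\<theta>\<close> by the sum of the moduli of
      its coefficients, which gives the constant for \<open>r * \<Phi> r\<close>.\<close>
    have "norm (complex_of_real (\<theta> (ln r))) \<le> (\<Sum>\<^sub>\<infinity>k. norm (ck k * trig (ln c) k (ln r)))"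
      using norm_infsum_bound[of "\<lambda>k. ck k * trig (ln c) k (ln r)" UNIV] summ infsumI[OF series[of "ln r"]]
      by (simp add: norm_mult)
    then show "r * \<Phi> r \<le> (\<Sum>\<^sub>\<infinity>k. norm (ck k))"
      using \<open>r > 0\<close> pos[of "ln r"] by (simp add: \<Phi>_def norm_mult)
  next
    show "(\<lambda>t. indicator {0<..} t *\<^sub>R \<Phi> t) \<in> borel_measurable borel"
      unfolding \<Phi>_def
      by (rule borel_measurable_continuous_on_indicator)
        (auto intro!: continuous_intros continuous_on_compose2[OF cont])
  qed
  define e where "e n = 1 / real (Suc n)" for n
  have e: "0 < e n" "e n \<le> 1" for n by (auto simp: e_def)
  have e0: "e \<longlonglongrightarrow> 0"
    unfolding e_def by (rule LIMSEQ_Suc[OF lim_1_over_n])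
  define z where "z n = complex_of_real (e n) - \<i> * of_real x" for n
  \<comment> \<open>The imaginary part stays 1 for every \<open>n\<close>, so the cancellations hold
    before the limit is taken.\<close>
  define w where "w n = complex_of_real (e n) + \<i>" for n
  have zlim: "z \<longlonglongrightarrow> - \<i> * of_real x" and wlim: "w \<longlonglongrightarrow> \<i>"
    unfolding z_def w_def using tendsto_diff[OF tendsto_of_real[OF e0] tendsto_const[of "\<i> * complex_of_real x"]]
      tendsto_add[OF tendsto_of_real[OF e0] tendsto_const[of "\<i>"]] by simp_all
  have nz: "norm (z n) \<le> 1 + \<bar>x\<bar>" and nw: "norm (w n) \<le> 2" for n
    using e[of n] norm_triangle_ineq4[of "complex_of_real (e n)" "\<i> * of_real x"] norm_triangle_ineq[of "complex_of_real (e n)" \<i>]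
    by (auto simp: z_def w_def norm_mult)
  define R where "R = 1 + \<bar>x\<bar>"
  define K where "K = exp 1 * R\<^sup>2 + 2 * exp 1 * R + 2"
  have envK: "integrable \<phi> (\<lambda>y. K * min 1 (y\<^sup>2))" using env by auto
  have meas: "damped u v \<in> borel_measurable \<phi>" for u v
  proof -
    have "damped u v \<in> borel_measurable borel"
      by (rule borel_measurable_continuous_onI) (auto simp: damped_def intro!: continuous_intros)
    then show ?thesis
      by (rule measurable_compose[OF id_meas])
  qed
  have lim0: "AE y in \<phi>. (\<lambda>n. damped (z n) (w n) y) \<longlonglongrightarrow> damped (- \<i> * of_real x) \<i> y"
    unfolding damped_def by (intro AE_I2 tendsto_intros zlim wlim) auto
  have bnd: "AE y in \<phi>. norm (damped (z n) (w n) y) \<le> K * min 1 (y\<^sup>2)" for n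
    using e[of n] nz[of n] unfolding K_def
    by (intro AE_I2 norm_damped_le) (auto simp: space z_def w_def R_def)
  note dc = integrable_dominated_convergence[OF meas meas envK lim0 bnd]
    integral_dominated_convergence[OF meas meas envK lim0 bnd]
  have eq: "damped (- \<i> * of_real x) \<i> = zolotarev_integrand x"
    by (rule ext) (rule damped_imaginary)
  have int: "integrable \<phi> (zolotarev_integrand x)"
    using dc(1) unfolding eq .
  have lim: "(\<lambda>n. \<integral>y. damped (z n) (w n) y \<partial>\<phi>) \<longlonglongrightarrow> \<psi> x"
    using dc(2) unfolding eq \<psi> zolotarev_log_char_def .
  define f where "f k = ck k * Gamma (\<i> * of_int k * of_real ct) *
        ((- \<i> * of_real x) powr (1 - \<i> * of_int k * of_real ct)
         + \<i> * of_real x * cos (of_real (pi / 2) * \<i> * of_int k * of_real ct))" for k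
  show "integrable \<phi> (zolotarev_integrand x) \<and> f summable_on (UNIV - {0}) \<and>
     \<psi> x = - (\<Sum>\<^sub>\<infinity>k\<in>UNIV - {0}. f k) - ck 0 * \<i> * of_real x * Ln (- \<i> * of_real x)"
  \<comment> \<open>For \<open>x = 0\<close> the points \<open>z n\<close> run into the end of the
    branch cut, where the continuity argument does not apply; there the integrand and all terms are
    0.\<close>
  proof (cases "x = 0")
    case True
    have "zolotarev_integrand x = (\<lambda>y. 0)" by (auto simp: True zolotarev_integrand_def)
    moreover have "f = (\<lambda>k. 0)" by (auto simp: True f_def)
    ultimately show ?thesis using True by (simp add: \<psi> zolotarev_log_char_def)
  next
    case False
    define A where "A k n = damped_mellin (of_int k * ct) (z n) (w n)" for k n
    define A0 where "A0 k = damped_mellin (of_int k * ct) (- \<i> * of_real x) \<i>" for k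
    define G where "G = sqrt (2 * pi / (ct * (1 - exp (- (2 * pi * ct)))))"
    have G: "G \<ge> 0" unfolding G_def using ct0 by simp
    \<comment> \<open>The 3 bounds \<open>1 + norm (w n)\<close>, and \<open>ct\<close> is the least
      value of \<open>|k * ct|\<close> for \<open>k \<noteq> 0\<close>; one constant serves all such
      \<open>k\<close> and all \<open>n\<close>.\<close>
    define C where "C = G * (R * 3)"
    have AC: "norm (A k n) \<le> C" if "k \<noteq> 0" for k n
    proof -
      have "\<bar>of_int k * ct\<bar> \<ge> ct"
        using that ct0 by (simp add: abs_mult)
      then have "norm (A k n) \<le> G * (norm (z n) * (1 + norm (w n)))"
        unfolding A_def G_def using e[of n] ct0 by (intro norm_damped_mellin_le) (auto simp: z_def w_def)
      also have "\<dots> \<le> G * (R * (1 + 2))"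
        using nz[of n] nw[of n] G by (intro mult_left_mono mult_mono) (auto simp: R_def)
      finally show ?thesis by (simp add: C_def)
    qed
    have Alim: "A k \<longlonglongrightarrow> A0 k" for k
      unfolding A_def[abs_def] A0_def using False
      by (intro tendsto_damped_mellin zlim wlim) (auto simp: complex_nonpos_Reals_iff)
    have summC: "(\<lambda>k. norm (ck k) * C) summable_on UNIV - {0}"
      by (intro summable_on_cmult_left summable_on_subset_banach[OF summ]) auto
    have bound: "norm (ck k * A k n) \<le> norm (ck k) * C" if "k \<in> UNIV - {0}" for k n
      using AC[of k n] that by (auto simp: norm_mult intro!: mult_left_mono)
    have bound0: "norm (ck k * A0 k) \<le> norm (ck k) * C" if "k \<in> UNIV - {0}" for k
      by (rule LIMSEQ_le_const2[OF tendsto_norm[OF tendsto_mult[OF tendsto_const Alim]]]) (use bound[OF that] in auto)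
    have sA: "(\<lambda>k. ck k * A k n) summable_on UNIV - {0}" for n
      using bound by (intro abs_summable_summable[OF summable_on_comparison_test[OF summC]]) auto
    have sA0: "(\<lambda>k. ck k * A0 k) summable_on UNIV - {0}"
      using bound0 by (intro abs_summable_summable[OF summable_on_comparison_test[OF summC]]) auto
    \<comment> \<open>Both sides are limits of the same symmetric partial sums, one by the tail
      integral and the other by absolute summability.\<close>
    have val: "(\<integral>y. damped (z n) (w n) y \<partial>\<phi>) = ck 0 * A 0 n + (\<Sum>\<^sub>\<infinity>k\<in>UNIV - {0}. ck k * A k n)" for n
    proof (rule LIMSEQ_unique)
      show "(\<lambda>N. \<Sum>k = - int N..int N. ck k * A k n) \<longlonglongrightarrow> (\<integral>y. damped (z n) (w n) y \<partial>\<phi>)"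
        unfolding A_def ct
        by (rule damped_integral_fourier[OF sets_\<phi> tail_\<phi> pos cont summ series]) (use e[of n] in \<open>auto simp: z_def w_def\<close>)
      have "((\<lambda>k. ck k * A k n) has_sum (ck 0 * A 0 n + (\<Sum>\<^sub>\<infinity>k\<in>UNIV - {0}. ck k * A k n))) (insert 0 (UNIV - {0}))"
        by (rule has_sum_insert) (auto intro: has_sum_infsum sA)
      then show "(\<lambda>N. \<Sum>k = - int N..int N. ck k * A k n) \<longlonglongrightarrow> ck 0 * A 0 n + (\<Sum>\<^sub>\<infinity>k\<in>UNIV - {0}. ck k * A k n)"
        by (intro has_sum_imp_symmetric_limit) (simp add: insert_Diff)
    qed
    \<comment> \<open>Dominated convergence for the series: the majorant
      \<open>norm (ck k) * C\<close> makes the finite sums converge uniformly in \<open>n\<close>,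
      so summation and the limit of vanishing damping may be exchanged.\<close>
    have "(\<lambda>n. \<Sum>\<^sub>\<infinity>k\<in>UNIV - {0}. ck k * A k n) \<longlonglongrightarrow> (\<Sum>\<^sub>\<infinity>k\<in>UNIV - {0}. ck k * A0 k)"
    proof (rule swap_uniform_limit'[where S = UNIV])
      show "uniform_limit UNIV (\<lambda>X n. \<Sum>k\<in>X. ck k * A k n) (\<lambda>n. \<Sum>\<^sub>\<infinity>k\<in>UNIV - {0}. ck k * A k n) (finite_subsets_at_top (UNIV - {0}))"
        using bound summC by (intro Weierstrass_m_test_general) auto
      show "\<forall>\<^sub>F X in finite_subsets_at_top (UNIV - {0}). (\<lambda>n. \<Sum>k\<in>X. ck k * A k n) \<longlonglongrightarrow> (\<Sum>k\<in>X. ck k * A0 k)"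
        by (intro always_eventually allI tendsto_sum tendsto_mult tendsto_const Alim)
      show "((\<lambda>X. \<Sum>k\<in>X. ck k * A0 k) \<longlongrightarrow> (\<Sum>\<^sub>\<infinity>k\<in>UNIV - {0}. ck k * A0 k)) (finite_subsets_at_top (UNIV - {0}))"
        using has_sum_infsum[OF sA0] by (simp add: has_sum_def)
    qed auto
    then have "(\<lambda>n. \<integral>y. damped (z n) (w n) y \<partial>\<phi>) \<longlonglongrightarrow> ck 0 * A0 0 + (\<Sum>\<^sub>\<infinity>k\<in>UNIV - {0}. ck k * A0 k)"
      unfolding val by (intro tendsto_add tendsto_mult tendsto_const Alim)
    with lim have main: "\<psi> x = ck 0 * A0 0 + (\<Sum>\<^sub>\<infinity>k\<in>UNIV - {0}. ck k * A0 k)"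
      by (rule LIMSEQ_unique)
    have A00: "A0 0 = - \<i> * of_real x * Ln (- \<i> * of_real x)"
      unfolding A0_def using damped_mellin_boundary_0[of x] by simp
    have A0f: "ck k * A0 k = - f k" if "k \<in> UNIV - {0}" for k
    proof -
      have "of_int k * ct \<noteq> 0" using that ct0 by simp
      from damped_mellin_boundary[OF this False] show ?thesis
        by (simp add: A0_def f_def mult_ac)
    qed
    have "(\<lambda>k. - f k) summable_on UNIV - {0}"
      using sA0 by (rule summable_on_cong[THEN iffD1, rotated]) (rule A0f)
    then have "f summable_on UNIV - {0}"
      by (simp add: summable_on_uminus)
    moreover have "(\<Sum>\<^sub>\<infinity>k\<in>UNIV - {0}. ck k * A0 k) = - (\<Sum>\<^sub>\<infinity>k\<in>UNIV - {0}. f k)"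
      using infsum_cong[of "UNIV - {0}", OF A0f] by (simp add: infsum_uminus)
    ultimately show ?thesis
      using int main A00 by (simp add: mult_ac)
  qed
qed

end
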